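(* Let $\pi$ be a reproducing unitary representation of $G$ on $\mathcal H$ with admissible vector $u$, let $w$ be a control weight such that the kernel $K=Vu$ belongs to $L_{p,w}(G)$ for all $1<p<\infty$, let $m$ be a $w$-moderate weight, $Y=\bigcap_{1<p<\infty}L_{p,m}(G)$ and $\operatorname{Co}(Y)=\{T\in\mathcal S_w'\mid V_eT\in Y\}$. Then the following hold. 1. The image of the coorbit space under the extended voice transform is $$V_e(\operatorname{Co}(Y))=\{F\in Y\mid F*K=F\},$$ a closed subspace of $Y$, denoted $\mathcal M^Y$. 2. For all $f\in\mathcal M^Y$, the Fourier transform $\pi(f)u\in\mathcal S_w'$ given by $$\langle\pi(f)u,v\rangle_{\mathcal S_w}=\int_Gf(x)\langle\pi(x)u,v\rangle_{\mathcal H}\,dx,\qquad v\in\mathcal S_w,$$ belongs to the coorbit space $\operatorname{Co}(Y)$. 3. The extended voice transform on $\operatorname{Co}(Y)$ and the Fourier transform on $\mathcal M^Y$ at $u$ satisfy $$V_e(\pi(f)u)=f\quad(f\in\mathcal M^Y),\qquad \pi(V_eT)u=T\quad(T\in\operatorname{Co}(Y)).$$ 4. $V_e$ is a bijection from $\operatorname{Co}(Y)$ onto $\mathcal M^Y$ whose inverse is the map $f\mapsto\pi(f)u$.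
   Context: $G$ is a locally compact second countable group with left Haar measure $dx$. A control weight is a continuous $w:G\to(0,\infty)$ with $w(xy)\le w(x)w(y)$ and $w(x)=w(x^{-1})$. A $w$-moderate weight is a continuous $m:G\to(0,\infty)$ with $m(xy)\le w(x)m(y)$ and $m(xy)\le m(x)w(y)$ for all $x,y\in G$. For a positive continuous $v$, $\|f\|_{L_{p,v}}^p=\int_G|v(x)f(x)|^p\,dx$. $Y$ carries the initial topology with respect to the inclusions $Y\hookrightarrow L_{p,m}(G)$, $1<p<\infty$, for which it is a Fréchet space. Convolution: $f*g(x)=\int_Gf(y)g(y^{-1}x)\,dy$. $\pi$ is a strongly continuous unitary representation of $G$ on a separable complex Hilbert space $\mathcal H$ (scalar product linear in the first entry). It is reproducing with admissible vector $u\in\mathcal H$ if the voice transform $Vv(x)=\langle v,\pi(x)u\rangle_{\mathcal H}$ is an isometry from $\mathcal H$ into $L_2(G)$. The reproducing kernel is $K(x)=Vu(x)=\langle u,\pi(x)u\rangle_{\mathcal H}$. The test space is $\mathcal S_w=\{v\in\mathcal H\mid Vv\in L_{p,w}(G)\text{ for all }1<p<\infty\}$ with the seminorms $v\mapsto\|Vv\|_{L_{p,w}}$, $1<p<\infty$. It is a Fréchet space containing all vectors $\pi(x)u$, $x\in G$. $\mathcal S_w'$ is its anti-linear dual, with pairing $\langle\cdot,\cdot\rangle_{\mathcal S_w}$. The extended voice transform of $T\in\mathcal S_w'$ is $V_eT(x)=\langle T,\pi(x)u\rangle_{\mathcal S_w}$, $x\in G$. *)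

theory Defs
  imports "HOL-Analysis.Analysis"
begin

text \<open>
  Complex Hilbert spaces, with the scalar product linear in the first entry. The topology is the
  norm topology provided by \<^class>\<open>real_normed_vector\<close>.
\<close>

class complex_inner_space = real_normed_vector +
  fixes scaleC :: "complex \<Rightarrow> 'a \<Rightarrow> 'a" (infixr \<open>*\<^sub>C\<close> 75)
    and cinner :: "'a \<Rightarrow> 'a \<Rightarrow> complex"
  assumes scaleC_add_right: "a *\<^sub>C (x + y) = a *\<^sub>C x + a *\<^sub>C y"
    and scaleC_add_left: "(a + b) *\<^sub>C x = a *\<^sub>C x + b *\<^sub>C x"
    and scaleC_scaleC: "a *\<^sub>C b *\<^sub>C x = (a * b) *\<^sub>C x"
    and scaleC_of_real: "complex_of_real r *\<^sub>C x = r *\<^sub>R x"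
    and cinner_commute: "cinner x y = cnj (cinner y x)"
    and cinner_add_left: "cinner (x + y) z = cinner x z + cinner y z"
    and cinner_scaleC_left: "cinner (a *\<^sub>C x) y = a * cinner x y"
    and cinner_self: "cinner x x = complex_of_real ((norm x)\<^sup>2)"

class complex_hilbert_space = complex_inner_space + complete_space

text \<open>
  Topological groups are taken from \<^class>\<open>topological_group_add\<close>, which despite its additive
  notation does not assume commutativity: \<open>x + y\<close> is the product \<open>xy\<close>, \<open>0\<close> the identity,
  \<open>- x\<close> the inverse, and \<open>- y + x\<close> is \<open>y\<inverse>x\<close>.

  On a locally compact, second countable Hausdorff group, every Borel measure that is finite on
  compact sets is regular, so that regularity need not be demanded of a Haar measure.
\<close>

definition left_haar_measure :: "'g::topological_group_add measure \<Rightarrow> bool" where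
  "left_haar_measure M \<longleftrightarrow>
     sets M = sets borel \<and>
     emeasure M (space M) \<noteq> 0 \<and>
     (\<forall>C. compact C \<longrightarrow> emeasure M C < \<infinity>) \<and>
     (\<forall>x. \<forall>A\<in>sets M. emeasure M ((\<lambda>y. x + y) ` A) = emeasure M A)"

definition control_weight :: "('g::topological_group_add \<Rightarrow> real) \<Rightarrow> bool" where
  "control_weight w \<longleftrightarrow>
     continuous_on UNIV w \<and> (\<forall>x. w x > 0) \<and>
     (\<forall>x y. w (x + y) \<le> w x * w y) \<and> (\<forall>x. w x = w (- x))"

definition moderate_weight ::
    "('g::topological_group_add \<Rightarrow> real) \<Rightarrow> ('g \<Rightarrow> real) \<Rightarrow> bool" where
  "moderate_weight w m \<longleftrightarrow>
     continuous_on UNIV m \<and> (\<forall>x. m x > 0) \<and>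
     (\<forall>x y. m (x + y) \<le> w x * m y) \<and> (\<forall>x y. m (x + y) \<le> m x * w y)"


text \<open>
  Elements of the Lebesgue spaces are classes of measurable functions modulo equality almost
  everywhere. Operations on classes are defined through a representative \<open>rep F\<close>; none of them
  depends on the choice.
\<close>

definition ae_class :: "'g measure \<Rightarrow> ('g \<Rightarrow> complex) \<Rightarrow> ('g \<Rightarrow> complex) set" where
  "ae_class M f = {g \<in> borel_measurable M. AE x in M. g x = f x}"

definition rep :: "('g \<Rightarrow> complex) set \<Rightarrow> 'g \<Rightarrow> complex" where
  "rep F = (SOME f. f \<in> F)"

definition add_class ::
    "'g measure \<Rightarrow> ('g \<Rightarrow> complex) set \<Rightarrow> ('g \<Rightarrow> complex) set \<Rightarrow> ('g \<Rightarrow> complex) set" where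
  "add_class M F G = ae_class M (\<lambda>x. rep F x + rep G x)"

definition diff_class ::
    "'g measure \<Rightarrow> ('g \<Rightarrow> complex) set \<Rightarrow> ('g \<Rightarrow> complex) set \<Rightarrow> ('g \<Rightarrow> complex) set" where
  "diff_class M F G = ae_class M (\<lambda>x. rep F x - rep G x)"

definition scale_class ::
    "'g measure \<Rightarrow> complex \<Rightarrow> ('g \<Rightarrow> complex) set \<Rightarrow> ('g \<Rightarrow> complex) set" where
  "scale_class M c F = ae_class M (\<lambda>x. c * rep F x)"

definition Lp_fun :: "'g measure \<Rightarrow> real \<Rightarrow> ('g \<Rightarrow> real) \<Rightarrow> ('g \<Rightarrow> complex) set" where
  "Lp_fun M p v =
     {f \<in> borel_measurable M. integrable M (\<lambda>x. cmod (of_real (v x) * f x) powr p)}"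

definition Lp_norm :: "'g measure \<Rightarrow> real \<Rightarrow> ('g \<Rightarrow> real) \<Rightarrow> ('g \<Rightarrow> complex) \<Rightarrow> real" where
  "Lp_norm M p v f = (LINT x|M. cmod (of_real (v x) * f x) powr p) powr (1 / p)"

definition Lp_space :: "'g measure \<Rightarrow> real \<Rightarrow> ('g \<Rightarrow> real) \<Rightarrow> ('g \<Rightarrow> complex) set set" where
  "Lp_space M p v = ae_class M ` Lp_fun M p v"

definition Lp_topology ::
    "'g measure \<Rightarrow> real \<Rightarrow> ('g \<Rightarrow> real) \<Rightarrow> ('g \<Rightarrow> complex) set topology" where
  "Lp_topology M p v =
     Metric_space.mtopology (Lp_space M p v) (\<lambda>F G. Lp_norm M p v (rep (diff_class M F G)))"

definition Y_space :: "'g measure \<Rightarrow> ('g \<Rightarrow> real) \<Rightarrow> ('g \<Rightarrow> complex) set set" where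
  "Y_space M m = (\<Inter>p\<in>{1<..}. Lp_space M p m)"

text \<open>The initial topology with respect to the inclusions into the spaces \<^term>\<open>Lp_space M p m\<close>.\<close>

definition Y_topology :: "'g measure \<Rightarrow> ('g \<Rightarrow> real) \<Rightarrow> ('g \<Rightarrow> complex) set topology" where
  "Y_topology M m =
     topology_generated_by {Y_space M m \<inter> U | U p. 1 < p \<and> openin (Lp_topology M p m) U}"

definition closed_linear_subspace_of_Y ::
    "'g measure \<Rightarrow> ('g \<Rightarrow> real) \<Rightarrow> ('g \<Rightarrow> complex) set set \<Rightarrow> bool" where
  "closed_linear_subspace_of_Y M m S \<longleftrightarrow>
     S \<subseteq> Y_space M m \<and> ae_class M (\<lambda>x. 0) \<in> S \<and>
     (\<forall>F\<in>S. \<forall>G\<in>S. add_class M F G \<in> S) \<and> (\<forall>c. \<forall>F\<in>S. scale_class M c F \<in> S) \<and>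
     closedin (Y_topology M m) S"

definition convolution ::
    "'g::topological_group_add measure \<Rightarrow> ('g \<Rightarrow> complex) \<Rightarrow> ('g \<Rightarrow> complex) \<Rightarrow> 'g \<Rightarrow> complex" where
  "convolution M f g x = (LINT y|M. f y * g (- y + x))"


definition unitary_representation ::
    "('g::topological_group_add \<Rightarrow> 'h::complex_hilbert_space \<Rightarrow> 'h) \<Rightarrow> bool" where
  "unitary_representation \<pi> \<longleftrightarrow>
     (\<forall>x v v'. \<pi> x (v + v') = \<pi> x v + \<pi> x v') \<and>
     (\<forall>x c v. \<pi> x (c *\<^sub>C v) = c *\<^sub>C \<pi> x v) \<and>
     (\<forall>x. surj (\<pi> x)) \<and>
     (\<forall>x v v'. cinner (\<pi> x v) (\<pi> x v') = cinner v v') \<and>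
     \<pi> 0 = id \<and> (\<forall>x y. \<pi> (x + y) = \<pi> x \<circ> \<pi> y) \<and>
     (\<forall>v. continuous_on UNIV (\<lambda>x. \<pi> x v))"

definition voice ::
    "('g \<Rightarrow> 'h::complex_hilbert_space \<Rightarrow> 'h) \<Rightarrow> 'h \<Rightarrow> 'h \<Rightarrow> 'g \<Rightarrow> complex" where
  "voice \<pi> u v x = cinner v (\<pi> x u)"

definition reproducing_representation ::
    "'g::topological_group_add measure \<Rightarrow> ('g \<Rightarrow> 'h::complex_hilbert_space \<Rightarrow> 'h) \<Rightarrow> 'h \<Rightarrow> bool"
  where
  "reproducing_representation M \<pi> u \<longleftrightarrow>
     unitary_representation \<pi> \<and>
     (\<forall>v. voice \<pi> u v \<in> Lp_fun M 2 (\<lambda>x. 1) \<and> Lp_norm M 2 (\<lambda>x. 1) (voice \<pi> u v) = norm v)"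

definition repr_kernel ::
    "('g \<Rightarrow> 'h::complex_hilbert_space \<Rightarrow> 'h) \<Rightarrow> 'h \<Rightarrow> 'g \<Rightarrow> complex" where
  "repr_kernel \<pi> u = voice \<pi> u u"

definition test_space ::
    "'g measure \<Rightarrow> ('g \<Rightarrow> 'h::complex_hilbert_space \<Rightarrow> 'h) \<Rightarrow> 'h \<Rightarrow> ('g \<Rightarrow> real) \<Rightarrow> 'h set" where
  "test_space M \<pi> u w = {v. \<forall>p>1. voice \<pi> u v \<in> Lp_fun M p w}"

text \<open>The locally convex topology given by the seminorms \<^term>\<open>\<lambda>v. Lp_norm M p w (voice \<pi> u v)\<close>.\<close>

definition test_topology ::
    "'g measure \<Rightarrow> ('g \<Rightarrow> 'h::complex_hilbert_space \<Rightarrow> 'h) \<Rightarrow> 'h \<Rightarrow> ('g \<Rightarrow> real) \<Rightarrow> 'h topology"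
  where
  "test_topology M \<pi> u w =
     topology_generated_by
       {{v \<in> test_space M \<pi> u w. Lp_norm M p w (voice \<pi> u (v - v\<^sub>0)) < \<epsilon>} | v\<^sub>0 p \<epsilon>.
          v\<^sub>0 \<in> test_space M \<pi> u w \<and> 1 < p \<and> 0 < \<epsilon>}"

text \<open>
  Functionals on the test space are \<^const>\<open>extensional\<close> functions (equal to \<^const>\<open>undefined\<close> outside
  the test space), so that equality of functionals is equality on the test space; the pairing of
  \<open>T\<close> with \<open>v\<close> is \<open>T v\<close>.
\<close>

definition antidual_test_space ::
    "'g measure \<Rightarrow> ('g \<Rightarrow> 'h::complex_hilbert_space \<Rightarrow> 'h) \<Rightarrow> 'h \<Rightarrow> ('g \<Rightarrow> real) \<Rightarrow>
      ('h \<Rightarrow> complex) set" where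
  "antidual_test_space M \<pi> u w =
     {T \<in> extensional (test_space M \<pi> u w).
        (\<forall>v\<in>test_space M \<pi> u w. \<forall>v'\<in>test_space M \<pi> u w. T (v + v') = T v + T v') \<and>
        (\<forall>c. \<forall>v\<in>test_space M \<pi> u w. T (c *\<^sub>C v) = cnj c * T v) \<and>
        continuous_map (test_topology M \<pi> u w) euclidean T}"

definition ext_voice :: "('g \<Rightarrow> 'h \<Rightarrow> 'h) \<Rightarrow> 'h \<Rightarrow> ('h \<Rightarrow> complex) \<Rightarrow> 'g \<Rightarrow> complex" where
  "ext_voice \<pi> u T x = T (\<pi> x u)"

text \<open>The extended voice transform with values in classes of functions.\<close>

definition ext_voice_class ::
    "'g measure \<Rightarrow> ('g \<Rightarrow> 'h \<Rightarrow> 'h) \<Rightarrow> 'h \<Rightarrow> ('h \<Rightarrow> complex) \<Rightarrow> ('g \<Rightarrow> complex) set" where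
  "ext_voice_class M \<pi> u T = ae_class M (ext_voice \<pi> u T)"

definition coorbit_space ::
    "'g measure \<Rightarrow> ('g \<Rightarrow> 'h::complex_hilbert_space \<Rightarrow> 'h) \<Rightarrow> 'h \<Rightarrow> ('g \<Rightarrow> real) \<Rightarrow> ('g \<Rightarrow> real) \<Rightarrow>
      ('h \<Rightarrow> complex) set" where
  "coorbit_space M \<pi> u w m =
     {T \<in> antidual_test_space M \<pi> u w. ext_voice_class M \<pi> u T \<in> Y_space M m}"

text \<open>
  For \<open>F\<close> in \<^term>\<open>Y_space M m\<close> and a kernel in all the spaces \<open>L_{p,w}\<close>, the convolution integral
  converges absolutely at every point, by Hoelder's inequality and \<open>m x \<le> m y * w (- y + x)\<close>.
\<close>

definition reproducing_kernel_subspace ::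
    "'g::topological_group_add measure \<Rightarrow> ('g \<Rightarrow> 'h::complex_hilbert_space \<Rightarrow> 'h) \<Rightarrow> 'h \<Rightarrow>
      ('g \<Rightarrow> real) \<Rightarrow> ('g \<Rightarrow> complex) set set" where
  "reproducing_kernel_subspace M \<pi> u m =
     {F \<in> Y_space M m. ae_class M (convolution M (rep F) (repr_kernel \<pi> u)) = F}"

definition fourier_at ::
    "'g measure \<Rightarrow> ('g \<Rightarrow> 'h::complex_hilbert_space \<Rightarrow> 'h) \<Rightarrow> 'h \<Rightarrow> ('g \<Rightarrow> real) \<Rightarrow>
      ('g \<Rightarrow> complex) set \<Rightarrow> 'h \<Rightarrow> complex" where
  "fourier_at M \<pi> u w F =
     (\<lambda>v\<in>test_space M \<pi> u w. LINT x|M. rep F x * cinner (\<pi> x u) v)"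

end

theory Submission
  imports Defs
begin

text \<open>
  Since \<open>V v x = \<langle>v, \<pi>(x)u\<rangle>\<close> and \<open>K (y\<inverse>x) = \<langle>\<pi>(y)u, \<pi>(x)u\<rangle>\<close>, the isometry of the voice transform
  is, after polarization, the reproducing formula \<open>V v * K = V v\<close>; weakly,
  \<open>v = \<integral> V v(x) \<pi>(x)u dx\<close>. Everything rests on making this formula valid in the test space, so that
  a functional may be applied under the integral sign:
  \<open>T v = \<integral> T(\<pi>(x)u) \<langle>\<pi>(x)u, v\<rangle> dx\<close> for every \<open>T\<close> in the coorbit space. This is
  \<open>functional_reconstruction\<close>, and it says that the Fourier transform of the extended voice transform
  of \<open>T\<close> is \<open>T\<close>. Evaluated at \<open>v = \<pi>(y)u\<close> it gives \<open>V\<^sub>e T * K = V\<^sub>e T\<close>.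

  The converse direction is formal. For \<open>f\<close> in \<open>Y\<close>, the moderateness of \<open>m\<close> gives
  \<open>m(0) \<le> m(x) w(x)\<close>, hence \<open>\<pi>(f)u\<close> is a continuous functional by the Cauchy-Schwarz inequality
  (\<open>pairing\<close>), and its extended voice transform is \<open>f * K\<close> by definition.

  The integral \<open>\<integral> V v(x) \<pi>(x)u dx\<close> need not converge absolutely in the test space, because \<open>V v\<close>
  lies in \<open>L\<^sub>p\<close> for \<open>p > 1\<close> only. It is therefore approximated by finite sums
  \<open>\<Sum>\<^sub>j (\<integral>\<^bsub>E\<^sub>j\<^esub> V v) \<pi>(x\<^sub>j)u\<close> over disjoint sets \<open>E\<^sub>j\<close> of finite measure (\<open>approximation\<close>). The error has
  two parts. What lies outside the union of the \<open>E\<^sub>j\<close> contributes the convolution of a restriction of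
  \<open>V v\<close> with \<open>K\<close>, which is small by Young's inequality with both factors in \<open>L\<^sub>q\<close>,
  \<open>q = 2p/(p+1) > 1\<close> (\<open>Young_convolution\<close>). Replacing \<open>\<pi>(x)u\<close> by \<open>\<pi>(x\<^sub>j)u\<close> on \<open>E\<^sub>j\<close> costs little because
  the orbit map \<open>x \<mapsto> \<pi>(x)u\<close> is continuous into the test space (\<open>orbit_continuous\<close>), so that by the
  Lindeloef property countably many sets of small oscillation suffice. A continuous functional is
  bounded by finitely many of the seminorms (\<open>antidual_bounded\<close>), so an approximation in finitely many
  exponents at a time is enough.

  The modular function never enters: the kernel satisfies \<open>\<bar>K(x\<inverse>)\<bar> = \<bar>K(x)\<bar>\<close>, which turns the
  reflected argument \<open>y\<inverse>x\<close>, as a function of \<open>y\<close>, into the left translate \<open>x\<inverse>y\<close> in Young's inequality. Closedness of the reproducing kernel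
  subspace holds already for \<open>L\<^sub>2\<close>-convergence: if \<open>F\<^sub>n\<close> converges to \<open>F\<close>, then \<open>F\<^sub>n * K\<close> converges to
  \<open>F * K\<close> at every point, and a subsequence of \<open>F\<^sub>n\<close> converges to \<open>F\<close> almost everywhere.
\<close>

section \<open>Scalar products\<close>

lemma cinner_add_right: "cinner x (y + z) = cinner x y + cinner x (z::'a::complex_inner_space)"
  by (metis cinner_add_left cinner_commute complex_cnj_add)

lemma cinner_scaleC_right: "cinner x (c *\<^sub>C y) = cnj c * cinner x (y::'a::complex_inner_space)"
  by (metis cinner_scaleC_left cinner_commute complex_cnj_mult)

lemma cinner_zero_left [simp]: "cinner 0 (x::'a::complex_inner_space) = 0"
  using cinner_add_left[of 0 0 x] by simp

lemma cinner_zero_right [simp]: "cinner (x::'a::complex_inner_space) 0 = 0"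
  using cinner_add_right[of x 0 0] by simp

lemma cinner_minus_left: "cinner (- x) (y::'a::complex_inner_space) = - cinner x y"
  using cinner_add_left[of x "- x" y] by (simp add: add_eq_0_iff)

lemma cinner_minus_right: "cinner x (- y) = - cinner x (y::'a::complex_inner_space)"
  using cinner_add_right[of x y "- y"] by (simp add: add_eq_0_iff)

lemma cinner_diff_left: "cinner (x - y) z = cinner x z - cinner y (z::'a::complex_inner_space)"
  using cinner_add_left[of x "- y" z] by (simp add: cinner_minus_left)

lemma cinner_diff_right: "cinner x (y - z) = cinner x y - cinner x (z::'a::complex_inner_space)"
  using cinner_add_right[of x y "- z"] by (simp add: cinner_minus_right)

lemma cinner_sum_left:
  "cinner (\<Sum>i\<in>I. f i) (y::'a::complex_inner_space) = (\<Sum>i\<in>I. cinner (f i) y)"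
  by (induction I rule: infinite_finite_induct) (auto simp: cinner_add_left)

lemma norm_add_scaleC_square:
  "(norm (x + c *\<^sub>C y))\<^sup>2 = (norm x)\<^sup>2 + (cmod c)\<^sup>2 * (norm y)\<^sup>2 + 2 * Re (cnj c * cinner x y)"
  for x y :: "'a::complex_inner_space"
proof -
  have "complex_of_real ((norm (x + c *\<^sub>C y))\<^sup>2) = cinner (x + c *\<^sub>C y) (x + c *\<^sub>C y)"
    by (simp add: cinner_self)
  also have "\<dots> = cinner x x + (c * cnj c) * cinner y y + (cnj c * cinner x y + cnj (cnj c * cinner x y))"
    by (simp add: cinner_add_left cinner_add_right cinner_scaleC_left cinner_scaleC_right
        cinner_commute[of y x] algebra_simps)
  also have "\<dots> = complex_of_real ((norm x)\<^sup>2 + (cmod c)\<^sup>2 * (norm y)\<^sup>2 + 2 * Re (cnj c * cinner x y))"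
    unfolding complex_add_cnj by (simp add: cinner_self complex_norm_square[symmetric] del: complex_cnj_mult)
  finally show ?thesis
    using of_real_eq_iff by blast
qed

lemma cinner_Cauchy_Schwarz: "cmod (cinner x y) \<le> norm x * norm (y::'a::complex_inner_space)"
proof (cases "norm y = 0")
  case True
  then show ?thesis by simp
next
  case False
  define c where "c = - cinner x y / of_real ((norm y)\<^sup>2)"
  have "cnj c * cinner x y = of_real (- ((cmod (cinner x y))\<^sup>2 / (norm y)\<^sup>2))"
    unfolding c_def of_real_minus of_real_divide complex_norm_square by simp
  then have "Re (cnj c * cinner x y) = - ((cmod (cinner x y))\<^sup>2 / (norm y)\<^sup>2)"
    using Re_complex_of_real by presburger
  moreover have "(cmod c)\<^sup>2 * (norm y)\<^sup>2 = (cmod (cinner x y))\<^sup>2 / (norm y)\<^sup>2"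
    using False unfolding c_def by (simp add: norm_divide norm_mult power2_eq_square)
  ultimately have "0 \<le> (norm x)\<^sup>2 - (cmod (cinner x y))\<^sup>2 / (norm y)\<^sup>2"
    using norm_add_scaleC_square[of x c y] zero_le_power2[of "norm (x + c *\<^sub>C y)"] by linarith
  then have "(cmod (cinner x y))\<^sup>2 \<le> (norm x * norm y)\<^sup>2"
    using False by (simp add: divide_le_eq power_mult_distrib)
  then show ?thesis
    by (rule power2_le_imp_le) simp
qed

section \<open>Hoelder and Minkowski inequalities\<close>

lemma Holder_inequality:
  fixes f g :: "'a \<Rightarrow> real"
  assumes "1 < p" "1 < q" "1/p + 1/q = 1"
    and [measurable]: "f \<in> borel_measurable M" "g \<in> borel_measurable M"
    and nn: "\<And>x. 0 \<le> f x" "\<And>x. 0 \<le> g x"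
    and int: "integrable M (\<lambda>x. f x powr p)" "integrable M (\<lambda>x. g x powr q)"
  shows "integrable M (\<lambda>x. f x * g x)"
    and "(LINT x|M. f x * g x) \<le> (LINT x|M. f x powr p) powr (1/p) * (LINT x|M. g x powr q) powr (1/q)"
proof -
  have Young: "f x * g x \<le> f x powr p / p + g x powr q / q" for x
    using Youngs_inequality[of p q "f x" "g x"] assms by auto
  show i: "integrable M (\<lambda>x. f x * g x)"
  proof (rule Bochner_Integration.integrable_bound)
    show "integrable M (\<lambda>x. f x powr p / p + g x powr q / q)"
      using int by simp
    show "AE x in M. norm (f x * g x) \<le> norm (f x powr p / p + g x powr q / q)"
      using Young nn assms by (auto intro!: AE_I2)
  qed simp
  define A where "A = (LINT x|M. f x powr p)"
  define B where "B = (LINT x|M. g x powr q)"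
  have "A \<ge> 0" "B \<ge> 0"
    unfolding A_def B_def by simp_all
  consider "A = 0" | "B = 0" | "A > 0" "B > 0"
    using \<open>A \<ge> 0\<close> \<open>B \<ge> 0\<close> by linarith
  then show "(LINT x|M. f x * g x) \<le> A powr (1/p) * B powr (1/q)"
  proof cases
    case 1
    then have "AE x in M. f x powr p = 0"
      unfolding A_def using integral_nonneg_eq_0_iff_AE[OF int(1)] by auto
    then have "AE x in M. f x * g x = 0"
      by eventually_elim auto
    then show ?thesis
      using integral_cong_AE[of "\<lambda>x. f x * g x" M "\<lambda>x. 0"] by simp
  next
    case 2
    then have "AE x in M. g x powr q = 0"
      unfolding B_def using integral_nonneg_eq_0_iff_AE[OF int(2)] by auto
    then have "AE x in M. f x * g x = 0"
      by eventually_elim auto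
    then show ?thesis
      using integral_cong_AE[of "\<lambda>x. f x * g x" M "\<lambda>x. 0"] by simp
  next
    case 3
    define a where "a = A powr (1/p)"
    define b where "b = B powr (1/q)"
    have ab: "a > 0" "b > 0" "a powr p = A" "b powr q = B"
      using 3 assms by (auto simp: a_def b_def powr_powr)
    have "f x * g x \<le> a * b * (f x powr p / (A * p) + g x powr q / (B * q))" for x
    proof -
      have "(f x / a) * (g x / b) \<le> (f x / a) powr p / p + (g x / b) powr q / q"
        using Youngs_inequality[of p q "f x / a" "g x / b"] assms ab by auto
      also have "\<dots> = f x powr p / (A * p) + g x powr q / (B * q)"
        using nn ab by (simp add: powr_divide)
      finally show ?thesis
        using ab by (simp add: field_simps)
    qed
    then have "(LINT x|M. f x * g x) \<le> (LINT x|M. a * b * (f x powr p / (A * p) + g x powr q / (B * q)))"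
      using i int by (intro integral_mono) auto
    also have "\<dots> = a * b * (A / (A * p) + B / (B * q))"
      using int by (simp add: A_def B_def)
    also have "\<dots> = a * b"
      using 3 assms by simp
    finally show ?thesis
      unfolding a_def b_def .
  qed
qed

text \<open>Convexity of \<open>t \<mapsto> t\<^sup>p\<close>, rescaled so that integrating it gives the triangle inequality
  when \<open>a\<close> and \<open>b\<close> are bounds of the two norms.\<close>

lemma powr_add_le_weighted:
  fixes a b x y p :: real
  assumes "1 \<le> p" "0 < a" "0 < b" "0 \<le> x" "0 \<le> y"
  shows "(x + y) powr p \<le> (a + b) powr p * (a / (a + b) * (x / a) powr p + b / (a + b) * (y / b) powr p)"
proof -
  define s where "s = a / (a + b)"
  define t where "t = b / (a + b)"
  have st: "0 < s" "0 < t" "s + t = 1"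
    using assms by (auto simp: s_def t_def add_divide_distrib[symmetric])
  have small: "r powr p \<le> r" if "0 < r" "r \<le> 1" for r :: real
    using powr_mono'[of 1 p r] that assms by simp
  have conv: "(s * \<xi> + t * \<eta>) powr p \<le> s * \<xi> powr p + t * \<eta> powr p" if "0 \<le> \<xi>" "0 \<le> \<eta>" for \<xi> \<eta>
  proof (cases "\<xi> = 0 \<or> \<eta> = 0")
    case True
    then show ?thesis
      using small[of s] small[of t] st that
      by (auto simp: powr_mult intro!: mult_right_mono)
  next
    case False
    then show ?thesis
      using convex_onD[OF powr_convex[OF \<open>1 \<le> p\<close>], of t \<xi> \<eta>] st that
      by (simp add: eq_diff_eq[symmetric])
  qed
  have "x + y = (a + b) * (s * (x / a) + t * (y / b))"
    using assms by (simp add: s_def t_def distrib_left)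
  then have "(x + y) powr p = (a + b) powr p * (s * (x / a) + t * (y / b)) powr p"
    using assms st by (simp add: powr_mult)
  also have "\<dots> \<le> (a + b) powr p * (s * (x / a) powr p + t * (y / b) powr p)"
    using assms by (intro mult_left_mono conv) auto
  finally show ?thesis
    unfolding s_def t_def .
qed

section \<open>Weighted Lebesgue spaces\<close>

lemma Lp_fun_measurable: "f \<in> Lp_fun M p v \<Longrightarrow> f \<in> borel_measurable M"
  by (simp add: Lp_fun_def)

lemma Lp_fun_integrable:
  "f \<in> Lp_fun M p v \<Longrightarrow> integrable M (\<lambda>x. cmod (of_real (v x) * f x) powr p)"
  by (simp add: Lp_fun_def)

lemma Lp_norm_nonneg [simp]: "0 \<le> Lp_norm M p v f"
  by (simp add: Lp_norm_def)

lemma Lp_norm_zero [simp]: "Lp_norm M p v (\<lambda>x. 0) = 0"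
  by (simp add: Lp_norm_def)

lemma Lp_fun_zero [simp]: "(\<lambda>x. 0) \<in> Lp_fun M p v"
  by (simp add: Lp_fun_def)

lemma Lp_norm_powr: "0 < p \<Longrightarrow> Lp_norm M p v f powr p = (LINT x|M. cmod (of_real (v x) * f x) powr p)"
  by (simp add: Lp_norm_def powr_powr)

lemma Lp_norm_le:
  assumes "0 < p" "0 \<le> c" "(LINT x|M. cmod (of_real (v x) * f x) powr p) \<le> c powr p"
  shows "Lp_norm M p v f \<le> c"
proof -
  have "Lp_norm M p v f \<le> (c powr p) powr (1/p)"
    unfolding Lp_norm_def using assms by (intro powr_mono2) auto
  then show ?thesis
    using assms by (simp add: powr_powr)
qed

lemma Lp_fun_scale: "f \<in> Lp_fun M p v \<Longrightarrow> (\<lambda>x. c * f x) \<in> Lp_fun M p v"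
proof -
  assume f: "f \<in> Lp_fun M p v"
  have "(\<lambda>x. cmod (of_real (v x) * (c * f x)) powr p) = (\<lambda>x. cmod c powr p * cmod (of_real (v x) * f x) powr p)"
    by (auto simp: norm_mult powr_mult mult_ac)
  then show ?thesis
    using f by (auto simp: Lp_fun_def)
qed

lemma Lp_norm_scale: "0 < p \<Longrightarrow> Lp_norm M p v (\<lambda>x. c * f x) = cmod c * Lp_norm M p v f"
proof -
  assume p: "0 < p"
  have "(\<lambda>x. cmod (of_real (v x) * (c * f x)) powr p) = (\<lambda>x. cmod c powr p * cmod (of_real (v x) * f x) powr p)"
    by (auto simp: norm_mult powr_mult mult_ac)
  then show ?thesis
    using p by (simp add: Lp_norm_def powr_mult powr_powr)
qed

lemma Lp_fun_cong_AE:
  assumes [measurable]: "v \<in> borel_measurable M" "g \<in> borel_measurable M"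
    and "f \<in> Lp_fun M p v" "AE x in M. g x = f x"
  shows "g \<in> Lp_fun M p v"
proof -
  have [measurable]: "f \<in> borel_measurable M" using assms by (simp add: Lp_fun_def)
  have "integrable M (\<lambda>x. cmod (of_real (v x) * g x) powr p) =
        integrable M (\<lambda>x. cmod (of_real (v x) * f x) powr p)"
    using assms(4) by (intro integrable_cong_AE) auto
  then show ?thesis
    using assms by (simp add: Lp_fun_def)
qed

lemma Lp_norm_cong_AE:
  assumes [measurable]: "v \<in> borel_measurable M" "g \<in> borel_measurable M" "f \<in> borel_measurable M"
    and "AE x in M. g x = f x"
  shows "Lp_norm M p v g = Lp_norm M p v f"
proof -
  have "(LINT x|M. cmod (of_real (v x) * g x) powr p) = (LINT x|M. cmod (of_real (v x) * f x) powr p)"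
    using assms(4) by (intro integral_cong_AE) auto
  then show ?thesis
    by (simp add: Lp_norm_def)
qed

text \<open>Strict upper bounds \<open>a\<close>, \<open>b\<close> in place of the norms themselves are positive, so that one may divide
  by them even if a norm vanishes; Minkowski's inequality follows on letting them decrease to the
  norms.\<close>

lemma Lp_minkowski_bound:
  assumes [measurable]: "v \<in> borel_measurable M"
    and "1 < p" "f \<in> Lp_fun M p v" "g \<in> Lp_fun M p v"
    and a: "Lp_norm M p v f < a" and b: "Lp_norm M p v g < b"
  shows "(\<lambda>x. f x + g x) \<in> Lp_fun M p v \<and> Lp_norm M p v (\<lambda>x. f x + g x) \<le> a + b"
proof -
  have [measurable]: "f \<in> borel_measurable M" "g \<in> borel_measurable M"
    using assms by (auto simp: Lp_fun_def)
  have pos: "0 < a" "0 < b"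
    using a b Lp_norm_nonneg by (meson le_less_trans)+
  define F where "F x = cmod (of_real (v x) * f x)" for x
  define G where "G x = cmod (of_real (v x) * g x)" for x
  define S where "S x = (a + b) powr p * (a / (a + b) * (F x / a) powr p + b / (a + b) * (G x / b) powr p)" for x
  have S_eq: "S = (\<lambda>x. (a + b) powr p * (a / (a + b) * (F x powr p / a powr p) + b / (a + b) * (G x powr p / b powr p)))"
    using pos by (auto simp: S_def fun_eq_iff F_def G_def powr_divide)
  have int: "integrable M (\<lambda>x. F x powr p)" "integrable M (\<lambda>x. G x powr p)"
    using assms by (auto simp: F_def G_def Lp_fun_def)
  have intS: "integrable M S"
    unfolding S_eq using int by simp
  have le: "cmod (of_real (v x) * (f x + g x)) powr p \<le> S x" for x
  proof -
    have "cmod (of_real (v x) * (f x + g x)) powr p \<le> (F x + G x) powr p"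
      unfolding F_def G_def distrib_left using assms by (intro powr_mono2 norm_triangle_ineq) auto
    also have "\<dots> \<le> S x"
      unfolding S_def using assms pos by (intro powr_add_le_weighted) (auto simp: F_def G_def)
    finally show ?thesis .
  qed
  have int_sum: "integrable M (\<lambda>x. cmod (of_real (v x) * (f x + g x)) powr p)"
    by (rule Bochner_Integration.integrable_bound[OF intS])
       (use le in \<open>auto intro!: AE_I2 order.trans[OF le]\<close>)
  have fle: "(LINT x|M. F x powr p) \<le> a powr p"
    using powr_mono2[of p, OF _ _ less_imp_le[OF a]] Lp_norm_powr[of p M v f] assms by (simp add: F_def)
  have gle: "(LINT x|M. G x powr p) \<le> b powr p"
    using powr_mono2[of p, OF _ _ less_imp_le[OF b]] Lp_norm_powr[of p M v g] assms by (simp add: G_def)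
  have "(LINT x|M. cmod (of_real (v x) * (f x + g x)) powr p) \<le> (LINT x|M. S x)"
    using int_sum intS le by (intro integral_mono) auto
  also have "\<dots> = (a + b) powr p *
      (a / (a + b) * ((LINT x|M. F x powr p) / a powr p) + b / (a + b) * ((LINT x|M. G x powr p) / b powr p))"
    unfolding S_eq using int by simp
  also have "\<dots> \<le> (a + b) powr p * (a / (a + b) * 1 + b / (a + b) * 1)"
    using pos fle gle by (intro mult_left_mono add_mono) (auto simp: divide_le_eq)
  also have "\<dots> = (a + b) powr p"
    using pos by (simp add: add_divide_distrib[symmetric])
  finally have "Lp_norm M p v (\<lambda>x. f x + g x) \<le> a + b"
    using assms pos by (intro Lp_norm_le) auto
  then show ?thesis
    using int_sum by (simp add: Lp_fun_def)
qed

lemma Lp_fun_add: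
  assumes "v \<in> borel_measurable M" "1 < p" "f \<in> Lp_fun M p v" "g \<in> Lp_fun M p v"
  shows "(\<lambda>x. f x + g x) \<in> Lp_fun M p v"
  using Lp_minkowski_bound[OF assms, of "Lp_norm M p v f + 1" "Lp_norm M p v g + 1"] by simp

lemma Lp_norm_triangle:
  assumes "v \<in> borel_measurable M" "1 < p" "f \<in> Lp_fun M p v" "g \<in> Lp_fun M p v"
  shows "Lp_norm M p v (\<lambda>x. f x + g x) \<le> Lp_norm M p v f + Lp_norm M p v g"
proof (rule field_le_epsilon)
  fix e :: real assume "0 < e"
  then show "Lp_norm M p v (\<lambda>x. f x + g x) \<le> Lp_norm M p v f + Lp_norm M p v g + e"
    using Lp_minkowski_bound[OF assms, of "Lp_norm M p v f + e/2" "Lp_norm M p v g + e/2"] by simp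
qed

lemma Lp_fun_diff:
  assumes "v \<in> borel_measurable M" "1 < p" "f \<in> Lp_fun M p v" "g \<in> Lp_fun M p v"
  shows "(\<lambda>x. f x - g x) \<in> Lp_fun M p v"
  using Lp_fun_add[OF assms(1,2,3) Lp_fun_scale[OF assms(4), of "-1"]] by simp

lemma Lp_sum:
  assumes "v \<in> borel_measurable M" "1 < p" "\<And>j. j < N \<Longrightarrow> f j \<in> Lp_fun M p v"
  shows "(\<lambda>x. \<Sum>j<N. f j x) \<in> Lp_fun M p v \<and>
         Lp_norm M p v (\<lambda>x. \<Sum>j<N. f j x) \<le> (\<Sum>j<(N::nat). Lp_norm M p v (f j))"
  using assms(3)
proof (induction N)
  case (Suc N)
  then have IH: "(\<lambda>x. \<Sum>j<N. f j x) \<in> Lp_fun M p v"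
      "Lp_norm M p v (\<lambda>x. \<Sum>j<N. f j x) \<le> (\<Sum>j<N. Lp_norm M p v (f j))" and "f N \<in> Lp_fun M p v"
    by auto
  then show ?case
    using Lp_fun_add[OF assms(1,2)] Lp_norm_triangle[OF assms(1,2), of "\<lambda>x. \<Sum>j<N. f j x" "f N"]
    by force
qed simp

lemma Lp_norm_eq_0_iff:
  assumes [measurable]: "v \<in> borel_measurable M" and "1 < p" "f \<in> Lp_fun M p v" "\<And>x. v x \<noteq> 0"
  shows "Lp_norm M p v f = 0 \<longleftrightarrow> (AE x in M. f x = 0)"
proof -
  have "Lp_norm M p v f = 0 \<longleftrightarrow> (LINT x|M. cmod (of_real (v x) * f x) powr p) = 0"
    using assms by (simp add: Lp_norm_def)
  also have "\<dots> \<longleftrightarrow> (AE x in M. cmod (of_real (v x) * f x) powr p = 0)"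
    using assms by (intro integral_nonneg_eq_0_iff_AE) (auto simp: Lp_fun_def)
  also have "\<dots> \<longleftrightarrow> (AE x in M. f x = 0)"
    using assms by simp
  finally show ?thesis .
qed

text \<open>The condition on the weights says that \<open>v'\<close> dominates \<open>1/v\<close> up to a constant, so that the dual of
  a weighted \<open>L\<^sub>2\<close> contains the space with weight \<open>v'\<close>.\<close>

lemma Lp_duality:
  assumes [measurable]: "v \<in> borel_measurable M" "v' \<in> borel_measurable M"
    and f: "f \<in> Lp_fun M 2 v" and g: "g \<in> Lp_fun M 2 v'"
    and le: "\<And>x. 1 \<le> C * \<bar>v x\<bar> * \<bar>v' x\<bar>"
  shows "integrable M (\<lambda>x. f x * g x)"
    and "cmod (LINT x|M. f x * g x) \<le> C * Lp_norm M 2 v f * Lp_norm M 2 v' g"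
proof -
  define F where "F x = cmod (of_real (v x) * f x)" for x
  define G where "G x = cmod (of_real (v' x) * g x)" for x
  have [measurable]: "f \<in> borel_measurable M" "g \<in> borel_measurable M"
    using f g by (auto simp: Lp_fun_def)
  have [measurable]: "F \<in> borel_measurable M" "G \<in> borel_measurable M"
    unfolding F_def G_def by measurable
  have H: "integrable M (\<lambda>x. F x * G x)"
     "(LINT x|M. F x * G x) \<le> Lp_norm M 2 v f * Lp_norm M 2 v' g"
    using Holder_inequality[of 2 2 F M G] f g
    by (auto simp: F_def G_def Lp_fun_def Lp_norm_def)
  have le': "cmod (f x * g x) \<le> C * (F x * G x)" for x
    using mult_right_mono[OF le[of x], of "cmod (f x) * cmod (g x)"]
    by (simp add: F_def G_def norm_mult mult_ac)
  show i: "integrable M (\<lambda>x. f x * g x)"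
    by (rule Bochner_Integration.integrable_bound[where f = "\<lambda>x. C * (F x * G x)"])
       (use H le' in \<open>auto intro!: AE_I2 order.trans[OF le']\<close>)
  have "cmod (LINT x|M. f x * g x) \<le> (LINT x|M. cmod (f x * g x))"
    by simp
  also have "\<dots> \<le> (LINT x|M. C * (F x * G x))"
    using i H le' by (intro integral_mono) auto
  also have "\<dots> = C * (LINT x|M. F x * G x)"
    by simp
  also have "\<dots> \<le> C * (Lp_norm M 2 v f * Lp_norm M 2 v' g)"
  proof (rule mult_left_mono[OF H(2)])
    have "0 < C * (\<bar>v undefined\<bar> * \<bar>v' undefined\<bar>)"
      using le[of undefined] by (simp add: mult.assoc)
    then show "0 \<le> C"
      using zero_le_mult_iff[of C "\<bar>v undefined\<bar> * \<bar>v' undefined\<bar>"]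
      by (smt (verit) zero_less_mult_iff abs_ge_zero mult_nonneg_nonneg)
  qed
  finally show "cmod (LINT x|M. f x * g x) \<le> C * Lp_norm M 2 v f * Lp_norm M 2 v' g"
    by (simp add: mult.assoc)
qed

section \<open>Classes modulo equality almost everywhere\<close>

lemma ae_class_cong: "AE x in M. f x = g x \<Longrightarrow> ae_class M f = ae_class M g"
  unfolding ae_class_def by (auto elim!: AE_mp)

lemma rep_mem: "f \<in> F \<Longrightarrow> rep F \<in> F"
  unfolding rep_def using someI[of "\<lambda>f. f \<in> F"] by blast

lemma rep_ae_class:
  assumes "f \<in> borel_measurable M"
  shows "rep (ae_class M f) \<in> borel_measurable M" "AE x in M. rep (ae_class M f) x = f x"
  using rep_mem[of f "ae_class M f"] assms by (auto simp: ae_class_def)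

lemma ae_class_eq_iff:
  assumes "f \<in> borel_measurable M" "g \<in> borel_measurable M"
  shows "ae_class M f = ae_class M g \<longleftrightarrow> (AE x in M. f x = g x)"
  using assms ae_class_cong[of f g M] by (auto simp: ae_class_def)

lemma Lp_space_rep:
  assumes v: "v \<in> borel_measurable M" and "F \<in> Lp_space M p v"
  shows "rep F \<in> Lp_fun M p v" "ae_class M (rep F) = F"
proof -
  obtain f where f: "f \<in> Lp_fun M p v" "F = ae_class M f"
    using assms by (auto simp: Lp_space_def)
  note r = rep_ae_class[OF Lp_fun_measurable[OF f(1)]]
  show "rep F \<in> Lp_fun M p v"
    using Lp_fun_cong_AE[OF v r(1) f(1)] r f by simp
  show "ae_class M (rep F) = F"
    using ae_class_cong[OF r(2)] f by simp
qed

text \<open>The distance formula makes sense for all sets of functions; outside the space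
  the class may be empty, and then both orders of subtraction pick the same arbitrary function.\<close>

lemma Lp_norm_class_minus:
  assumes "v \<in> borel_measurable M"
  shows "Lp_norm M p v (rep (ae_class M (\<lambda>x. - f x))) = Lp_norm M p v (rep (ae_class M f))"
proof (cases "ae_class M f = {}")
  case True
  have "ae_class M (\<lambda>x. - f x) = {}"
  proof (rule ccontr)
    assume "ae_class M (\<lambda>x. - f x) \<noteq> {}"
    then obtain g where "g \<in> borel_measurable M" "AE x in M. g x = - f x"
      by (auto simp: ae_class_def)
    then have "(\<lambda>x. - g x) \<in> ae_class M f"
      by (auto simp: ae_class_def)
    with True show False by simp
  qed
  with True show ?thesis by simp
next
  case False
  then obtain g where g: "g \<in> borel_measurable M" "AE x in M. g x = f x"
    by (auto simp: ae_class_def)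
  have cl: "ae_class M f = ae_class M g" "ae_class M (\<lambda>x. - f x) = ae_class M (\<lambda>x. - g x)"
    using g(2) by (auto intro!: ae_class_cong)
  have mg: "(\<lambda>x. - g x) \<in> borel_measurable M"
    using g by simp
  have "Lp_norm M p v (rep (ae_class M (\<lambda>x. - g x))) = Lp_norm M p v (\<lambda>x. - g x)"
    by (rule Lp_norm_cong_AE[OF assms rep_ae_class(1)[OF mg] mg rep_ae_class(2)[OF mg]])
  also have "\<dots> = Lp_norm M p v g"
    by (simp add: Lp_norm_def)
  also have "\<dots> = Lp_norm M p v (rep (ae_class M g))"
    using Lp_norm_cong_AE[OF assms rep_ae_class(1)[OF g(1)] g(1) rep_ae_class(2)[OF g(1)]] by simp
  finally show ?thesis
    by (simp add: cl)
qed

lemma Lp_dist_eq: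
  assumes v: "v \<in> borel_measurable M" and "F \<in> Lp_space M p v" "G \<in> Lp_space M p v"
  shows "Lp_norm M p v (rep (diff_class M F G)) = Lp_norm M p v (\<lambda>x. rep F x - rep G x)"
proof -
  have m: "(\<lambda>x. rep F x - rep G x) \<in> borel_measurable M"
    using Lp_space_rep(1)[OF v] assms by (intro borel_measurable_diff Lp_fun_measurable)
  show ?thesis
    unfolding diff_class_def by (rule Lp_norm_cong_AE[OF v rep_ae_class(1)[OF m] m rep_ae_class(2)[OF m]])
qed

lemma Metric_space_Lp:
  assumes v: "v \<in> borel_measurable M" and "1 < p" "\<And>x. v x \<noteq> 0"
  shows "Metric_space (Lp_space M p v) (\<lambda>F G. Lp_norm M p v (rep (diff_class M F G)))"
proof
  fix F G H
  show "0 \<le> Lp_norm M p v (rep (diff_class M F G))"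
    by simp
  show "Lp_norm M p v (rep (diff_class M F G)) = Lp_norm M p v (rep (diff_class M G F))"
    using Lp_norm_class_minus[OF v, of p "\<lambda>x. rep F x - rep G x"] by (simp add: diff_class_def)
  assume F: "F \<in> Lp_space M p v" and G: "G \<in> Lp_space M p v"
  note rF = Lp_space_rep[OF v F] and rG = Lp_space_rep[OF v G]
  have "Lp_norm M p v (rep (diff_class M F G)) = 0 \<longleftrightarrow> (AE x in M. rep F x - rep G x = 0)"
    unfolding Lp_dist_eq[OF v F G]
    using Lp_norm_eq_0_iff[OF v \<open>1 < p\<close> Lp_fun_diff[OF v \<open>1 < p\<close> rF(1) rG(1)]] assms by simp
  also have "\<dots> \<longleftrightarrow> F = G"
    using ae_class_eq_iff[OF Lp_fun_measurable[OF rF(1)] Lp_fun_measurable[OF rG(1)]] rF rG by simp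
  finally show "Lp_norm M p v (rep (diff_class M F G)) = 0 \<longleftrightarrow> F = G" .
  assume H: "H \<in> Lp_space M p v"
  note rH = Lp_space_rep[OF v H]
  show "Lp_norm M p v (rep (diff_class M F H)) \<le>
     Lp_norm M p v (rep (diff_class M F G)) + Lp_norm M p v (rep (diff_class M G H))"
    unfolding Lp_dist_eq[OF v F G] Lp_dist_eq[OF v F H] Lp_dist_eq[OF v G H]
    using Lp_norm_triangle[OF v \<open>1 < p\<close> Lp_fun_diff[OF v \<open>1 < p\<close> rF(1) rG(1)]
        Lp_fun_diff[OF v \<open>1 < p\<close> rG(1) rH(1)]] by simp
qed

section \<open>Integral operators between Lebesgue spaces\<close>

text \<open>The common source of Young's inequality and of the bound for an integral over a set of finite
  measure. Hoelder's inequality in \<open>x\<close>, with the kernel split as \<open>g h\<close>, bounds the \<open>p\<close>-th power of the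
  integral by \<open>\<beta>\<^bsup>p-1\<^esup> \<integral> h\<^sup>p\<close>, and Tonelli's theorem integrates this in \<open>y\<close>. The
  product \<open>g h\<close> is integrable in \<open>x\<close> for almost every \<open>y\<close> only, which is all that the integration needs.\<close>

lemma (in pair_sigma_finite) kernel_operator_Lp:
  fixes k :: "'a \<Rightarrow> 'b \<Rightarrow> complex" and g h :: "'a \<Rightarrow> 'b \<Rightarrow> real"
  assumes p: "1 < p"
    and [measurable]: "v \<in> borel_measurable M2"
      "case_prod k \<in> borel_measurable (M1 \<Otimes>\<^sub>M M2)"
      "case_prod g \<in> borel_measurable (M1 \<Otimes>\<^sub>M M2)"
      "case_prod h \<in> borel_measurable (M1 \<Otimes>\<^sub>M M2)"
    and nn: "\<And>x y. 0 \<le> g x y" "\<And>x y. 0 \<le> h x y" "0 \<le> \<beta>"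
    and k: "\<And>x y. cmod (of_real (v y) * k x y) \<le> g x y * h x y"
    and g: "\<And>y. integrable M1 (\<lambda>x. g x y powr (p / (p - 1)))"
      "\<And>y. (LINT x|M1. g x y powr (p / (p - 1))) \<le> \<beta>"
    and h: "integrable (M1 \<Otimes>\<^sub>M M2) (\<lambda>(x, y). h x y powr p)"
  shows "(\<lambda>y. LINT x|M1. k x y) \<in> Lp_fun M2 p v"
    and "Lp_norm M2 p v (\<lambda>y. LINT x|M1. k x y) powr p
           \<le> \<beta> powr (p - 1) * (LINT x|M1. LINT y|M2. h x y powr p)"
proof -
  define q where "q = p / (p - 1)"
  have q: "1 < q" "1/q + 1/p = 1" "p / q = p - 1"
    using p by (auto simp: q_def field_simps)
  have [measurable]: "(\<lambda>y. LINT x|M1. k x y) \<in> borel_measurable M2"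
    by measurable
  define S where "S y = \<beta> powr (p - 1) * (LINT x|M1. h x y powr p)" for y
  have intS: "integrable M2 S"
    unfolding S_def using integrable_snd[OF h] by simp
  have le: "AE y in M2. cmod (of_real (v y) * (LINT x|M1. k x y)) powr p \<le> S y"
    using AE_integrable_snd[OF h] AE_space
  proof eventually_elim
    case (elim y)
    have [measurable]: "(\<lambda>x. g x y) \<in> borel_measurable M1" "(\<lambda>x. h x y) \<in> borel_measurable M1"
      using elim by measurable
    have Ho: "integrable M1 (\<lambda>x. g x y * h x y)"
      "(LINT x|M1. g x y * h x y)
        \<le> (LINT x|M1. g x y powr q) powr (1/q) * (LINT x|M1. h x y powr p) powr (1/p)"
      using Holder_inequality[of q p "\<lambda>x. g x y" M1 "\<lambda>x. h x y"] q p nn g(1)[of y] elim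
      by (auto simp: q_def)
    have "cmod (of_real (v y) * (LINT x|M1. k x y)) = cmod (LINT x|M1. of_real (v y) * k x y)"
      by simp
    also have "\<dots> \<le> (LINT x|M1. cmod (of_real (v y) * k x y))"
      by (rule integral_norm_bound)
    also have "\<dots> \<le> (LINT x|M1. g x y * h x y)"
      using nn k by (intro integral_mono'[OF Ho(1)]) auto
    also have "\<dots> \<le> \<beta> powr (1/q) * (LINT x|M1. h x y powr p) powr (1/p)"
      using q g(2)[of y] nn
      by (intro order.trans[OF Ho(2)] mult_right_mono powr_mono2) (auto simp flip: q_def)
    finally have "cmod (of_real (v y) * (LINT x|M1. k x y)) powr p
        \<le> (\<beta> powr (1/q) * (LINT x|M1. h x y powr p) powr (1/p)) powr p"
      using p by (intro powr_mono2) auto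
    also have "\<dots> = S y"
      using p q nn by (simp add: S_def powr_mult powr_powr)
    finally show ?case .
  qed
  have int: "integrable M2 (\<lambda>y. cmod (of_real (v y) * (LINT x|M1. k x y)) powr p)"
    by (rule Bochner_Integration.integrable_bound[OF intS])
       (use le in \<open>auto elim!: eventually_mono\<close>)
  then show "(\<lambda>y. LINT x|M1. k x y) \<in> Lp_fun M2 p v"
    by (simp add: Lp_fun_def)
  have "Lp_norm M2 p v (\<lambda>y. LINT x|M1. k x y) powr p
      = (LINT y|M2. cmod (of_real (v y) * (LINT x|M1. k x y)) powr p)"
    using p by (intro Lp_norm_powr) simp
  also have "\<dots> \<le> (LINT y|M2. S y)"
    by (rule integral_mono_AE[OF int intS le])
  also have "\<dots> = \<beta> powr (p - 1) * (LINT x|M1. LINT y|M2. h x y powr p)"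
    using Fubini_integral[OF h] by (simp add: S_def)
  finally show "Lp_norm M2 p v (\<lambda>y. LINT x|M1. k x y) powr p
      \<le> \<beta> powr (p - 1) * (LINT x|M1. LINT y|M2. h x y powr p)" .
qed

section \<open>Haar measure\<close>

locale haar_group =
  fixes M :: "'g::{topological_group_add, second_countable_topology, t2_space} measure"
  assumes locally_compact: "locally_compact_space (euclidean :: 'g topology)"
    and haar: "left_haar_measure M"
begin

lemma sets_M [measurable_cong, simp]: "sets M = sets borel"
  using haar by (simp add: left_haar_measure_def)

lemma space_M [simp]: "space M = UNIV"
  using sets_eq_imp_space_eq[OF sets_M] by simp

lemma sigma_finite: "sigma_finite_measure M"
proof
  define \<U> where "\<U> = {U :: 'g set. open U \<and> (\<exists>C. compact C \<and> U \<subseteq> C)}"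
  obtain \<V> where \<V>: "\<V> \<subseteq> \<U>" "countable \<V>" "\<Union>\<V> = \<Union>\<U>"
    using Lindelof[of \<U>] by (auto simp: \<U>_def)
  have "x \<in> \<Union>\<U>" for x
    using locally_compact unfolding locally_compact_space_def \<U>_def by fastforce
  then have "\<Union>\<V> = space M"
    using \<V> by auto
  moreover have "emeasure M V \<noteq> \<infinity>" if V: "V \<in> \<V>" for V
  proof -
    obtain C where C: "compact C" "V \<subseteq> C"
      using V \<V> by (auto simp: \<U>_def)
    then have "emeasure M V \<le> emeasure M C"
      by (intro emeasure_mono) (auto intro: borel_compact)
    also have "\<dots> < \<infinity>"
      using haar C by (simp add: left_haar_measure_def)
    finally show ?thesis by simp
  qed
  ultimately show "\<exists>A. countable A \<and> A \<subseteq> sets M \<and> \<Union>A = space M \<and> (\<forall>a\<in>A. emeasure M a \<noteq> \<infinity>)"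
    using \<V> by (intro exI[of _ \<V>]) (auto simp: \<U>_def)
qed

sublocale sigma_finite_measure M
  by (rule sigma_finite)

sublocale P: pair_sigma_finite M M ..

lemma measurable_translation [measurable]: "(\<lambda>y. x + y) \<in> measurable M M"
proof -
  have "(\<lambda>y. x + y) \<in> borel_measurable borel"
    by (intro borel_measurable_continuous_onI continuous_intros)
  then show ?thesis
    by (simp cong: measurable_cong_sets)
qed

lemma measurable_quotient [measurable]: "(\<lambda>(x, y). - x + y) \<in> measurable (M \<Otimes>\<^sub>M M) M"
proof -
  have "(\<lambda>z::'g \<times> 'g. - fst z + snd z) \<in> borel_measurable borel"
    by (intro borel_measurable_continuous_onI continuous_intros)
  moreover have "sets (borel :: ('g \<times> 'g) measure) = sets (M \<Otimes>\<^sub>M M)"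
    unfolding borel_prod[symmetric] by (rule sets_pair_measure_cong) simp_all
  ultimately show ?thesis
    by (simp add: case_prod_beta' cong: measurable_cong_sets)
qed

lemma distr_translation: "distr M M (\<lambda>y. x + y) = M"
proof (rule measure_eqI)
  fix A assume "A \<in> sets (distr M M (\<lambda>y. x + y))"
  then have A: "A \<in> sets M" by simp
  have "(\<lambda>y. x + y) -` A = (\<lambda>y. - x + y) ` A"
    by (force simp: image_iff algebra_simps simp flip: add.assoc)
  then have "emeasure (distr M M (\<lambda>y. x + y)) A = emeasure M ((\<lambda>y. - x + y) ` A)"
    using A by (simp add: emeasure_distr)
  also have "\<dots> = emeasure M A"
    using haar A by (simp add: left_haar_measure_def)
  finally show "emeasure (distr M M (\<lambda>y. x + y)) A = emeasure M A" .
qed simp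

lemma integral_translation:
  fixes f :: "'g \<Rightarrow> real"
  assumes "f \<in> borel_measurable M"
  shows "(LINT y|M. f (x + y)) = (LINT y|M. f y)"
  using integral_distr[OF measurable_translation assms, of x] by (simp add: distr_translation)

lemma integrable_translation:
  fixes f :: "'g \<Rightarrow> real"
  assumes "f \<in> borel_measurable M"
  shows "integrable M (\<lambda>y. f (x + y)) \<longleftrightarrow> integrable M f"
  using integrable_distr_eq[OF measurable_translation assms, of x] by (simp add: distr_translation)

lemma control_weight_measurable [measurable_dest]: "control_weight w \<Longrightarrow> w \<in> borel_measurable M"
  unfolding control_weight_def measurable_cong_sets[OF sets_M refl]
  by (blast intro: borel_measurable_continuous_onI)

lemma control_weight_pos: "control_weight w \<Longrightarrow> 0 < w x" for w :: "'g \<Rightarrow> real"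
  by (simp add: control_weight_def)

lemma control_weight_quotient: "control_weight w \<Longrightarrow> w y \<le> w x * w (- x + y)" for w :: "'g \<Rightarrow> real"
proof -
  assume "control_weight w"
  then have "w (x + (- x + y)) \<le> w x * w (- x + y)"
    by (simp only: control_weight_def)
  then show ?thesis
    by (simp flip: add.assoc)
qed

text \<open>Young's inequality with equal exponents, \<open>1/q + 1/q = 1 + 1/p\<close>. Submultiplicativity moves the weight
  onto the two factors, \<open>w(y) \<le> w(x) w(x\<inverse>y)\<close>. The product \<open>F(x) \<kappa>(x\<inverse>y)\<close> is split into its powers with
  exponents \<open>1 - q/p\<close> and \<open>q/p\<close>; the \<open>p/(p-1)\<close>-th power of the first one has exponent \<open>q/2\<close> and is
  integrated in \<open>x\<close> by the Cauchy-Schwarz inequality. There the symmetry of \<open>k\<close> is essential: without it,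
  the integral of \<open>\<kappa>(x\<inverse>y)\<^sup>q\<close> in \<open>x\<close> would involve the modular function.\<close>

lemma Young_convolution:
  assumes w: "control_weight w" and p: "1 < p" and q: "q = 2 * p / (p + 1)"
    and f: "f \<in> Lp_fun M q w" and k: "k \<in> Lp_fun M q w"
    and sym: "\<And>x. cmod (k (- x)) = cmod (k x)"
  shows "convolution M f k \<in> Lp_fun M p w"
    and "Lp_norm M p w (convolution M f k) \<le> Lp_norm M q w f * Lp_norm M q w k"
proof -
  note [measurable] = control_weight_measurable[OF w] Lp_fun_measurable[OF f] Lp_fun_measurable[OF k]
  define F where "F x = cmod (of_real (w x) * f x)" for x
  define \<kappa> where "\<kappa> x = cmod (of_real (w x) * k x)" for x
  have nn: "0 \<le> F x" "0 \<le> \<kappa> x" for x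
    by (auto simp: F_def \<kappa>_def)
  have [measurable]: "F \<in> borel_measurable M" "\<kappa> \<in> borel_measurable M"
    unfolding F_def \<kappa>_def by measurable
  have \<kappa>_sym: "\<kappa> (- x + y) = \<kappa> (- y + x)" for x y
  proof -
    have "w (- y + x) = w (- x + y)"
      using w unfolding control_weight_def by (metis minus_add minus_minus)
    moreover have "cmod (k (- y + x)) = cmod (k (- x + y))"
      using sym[of "- x + y"] by (simp add: minus_add)
    ultimately show ?thesis
      by (simp add: \<kappa>_def norm_mult)
  qed
  define A where "A = (LINT x|M. F x powr q)"
  define B where "B = (LINT x|M. \<kappa> x powr q)"
  have AB: "0 \<le> A" "0 \<le> B"
    by (auto simp: A_def B_def)
  have intF: "integrable M (\<lambda>x. F x powr q)" and int\<kappa>: "integrable M (\<lambda>x. \<kappa> x powr q)"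
    using f k by (auto simp: F_def \<kappa>_def Lp_fun_def)
  have q_gt: "1 < q" "q / p \<le> 1" "0 < q / p" "(1 - q / p) * (p / (p - 1)) = q / 2" "q / p * p = q"
  proof -
    have qp: "q / p = 2 / (p + 1)"
      using p by (simp add: q)
    have qp': "1 - 2 / (p + 1) = (p - 1) / (p + 1)"
      using p by (simp add: field_simps)
    show "1 < q" "q / p * p = q"
      using p by (auto simp: q)
    show "q / p \<le> 1" "0 < q / p"
      unfolding qp using p by auto
    show "(1 - q / p) * (p / (p - 1)) = q / 2"
      unfolding qp qp' q using p by (simp add: divide_simps)
  qed
  have int\<kappa>': "integrable M (\<lambda>x. \<kappa> (- x + y) powr q)" "(LINT x|M. \<kappa> (- x + y) powr q) = B" for y
    unfolding \<kappa>_sym[of _ y] B_def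
    using integrable_translation[of "\<lambda>x. \<kappa> x powr q" "- y"]
      integral_translation[of "\<lambda>x. \<kappa> x powr q" "- y"] int\<kappa> by simp_all
  have int\<kappa>2: "integrable M (\<lambda>y. \<kappa> (- x + y) powr q)" "(LINT y|M. \<kappa> (- x + y) powr q) = B" for x
    unfolding B_def
    using integrable_translation[of "\<lambda>y. \<kappa> y powr q" "- x"]
      integral_translation[of "\<lambda>y. \<kappa> y powr q" "- x"] int\<kappa> by simp_all
  define g where "g x y = (F x * \<kappa> (- x + y)) powr (1 - q / p)" for x y
  define h where "h x y = (F x * \<kappa> (- x + y)) powr (q / p)" for x y
  have [measurable]: "case_prod g \<in> borel_measurable (M \<Otimes>\<^sub>M M)" "case_prod h \<in> borel_measurable (M \<Otimes>\<^sub>M M)"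
    unfolding g_def h_def by measurable
  have h_powr: "h x y powr p = F x powr q * \<kappa> (- x + y) powr q" for x y
    using nn q_gt by (simp add: h_def powr_powr powr_mult)
  have g_powr: "g x y powr (p / (p - 1)) = F x powr (q / 2) * \<kappa> (- x + y) powr (q / 2)" for x y
    unfolding g_def powr_powr q_gt using nn by (simp add: powr_mult)
  have gint: "integrable M (\<lambda>x. g x y powr (p / (p - 1)))"
    and gle: "(LINT x|M. g x y powr (p / (p - 1))) \<le> (A * B) powr (1/2)" for y
    using Holder_inequality[of 2 2 "\<lambda>x. F x powr (q/2)" M "\<lambda>x. \<kappa> (- x + y) powr (q/2)"] intF int\<kappa>'[of y] nn AB
    by (auto simp: g_powr powr_powr A_def powr_mult)
  have hint: "integrable (M \<Otimes>\<^sub>M M) (\<lambda>(x, y). h x y powr p)"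
    using intF int\<kappa>2 nn by (intro P.Fubini_integrable) (auto simp: h_powr)
  have bound: "cmod (of_real (w y) * (f x * k (- x + y))) \<le> g x y * h x y" for x y
  proof -
    have "cmod (of_real (w y) * (f x * k (- x + y))) = w y * (cmod (f x) * cmod (k (- x + y)))"
      using control_weight_pos[OF w, of y] by (simp add: norm_mult)
    also have "\<dots> \<le> (w x * w (- x + y)) * (cmod (f x) * cmod (k (- x + y)))"
      by (intro mult_right_mono control_weight_quotient[OF w]) auto
    also have "\<dots> = F x * \<kappa> (- x + y)"
      using control_weight_pos[OF w] by (simp add: F_def \<kappa>_def norm_mult abs_of_pos)
    also have "\<dots> = g x y * h x y"
      using nn by (simp add: g_def h_def powr_add[symmetric])
    finally show ?thesis .
  qed
  note op = P.kernel_operator_Lp[of p w "\<lambda>x y. f x * k (- x + y)" g h "(A * B) powr (1/2)",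
      OF p _ _ _ _ _ _ _ bound gint gle hint]
  show "convolution M f k \<in> Lp_fun M p w"
    unfolding convolution_def[abs_def] by (rule op) (auto simp: g_def h_def)
  have "Lp_norm M p w (convolution M f k) powr p
     \<le> ((A * B) powr (1/2)) powr (p - 1) * (LINT x|M. LINT y|M. h x y powr p)"
    unfolding convolution_def[abs_def] by (rule op) (auto simp: g_def h_def)
  also have "(LINT x|M. LINT y|M. h x y powr p) = A * B"
    by (simp add: h_powr int\<kappa>2 A_def)
  also have "((A * B) powr (1/2)) powr (p - 1) * (A * B) = (A * B) powr ((p - 1) / 2 + 1)"
    using AB by (simp add: powr_powr powr_add)
  also have "(p - 1) / 2 + 1 = p / q"
    using p by (simp add: q field_simps)
  finally have "Lp_norm M p w (convolution M f k) powr p \<le> (A * B) powr (p / q)" .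
  then have "Lp_norm M p w (convolution M f k) \<le> (A * B) powr (1 / q)"
    using p by (intro Lp_norm_le) (auto simp: Lp_norm_powr powr_powr)
  then show "Lp_norm M p w (convolution M f k) \<le> Lp_norm M q w f * Lp_norm M q w k"
    using AB by (simp add: Lp_norm_def A_def B_def F_def \<kappa>_def powr_mult)
qed

text \<open>A quantitative form of Minkowski's integral inequality on a set of finite measure.\<close>

lemma integral_finite_measure_Lp:
  assumes [measurable]: "v \<in> borel_measurable M" "E \<in> sets M" "f \<in> borel_measurable M"
      "case_prod k \<in> borel_measurable (M \<Otimes>\<^sub>M M)"
    and p: "1 < p" and fin: "emeasure M E < \<infinity>"
    and f: "\<And>x. cmod (f x) \<le> C"
    and k: "\<And>x. x \<in> E \<Longrightarrow> k x \<in> Lp_fun M p v" "\<And>x. x \<in> E \<Longrightarrow> Lp_norm M p v (k x) \<le> \<epsilon>"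
    and "0 \<le> \<epsilon>"
  shows "(\<lambda>y. LINT x|M. indicator E x * f x * k x y) \<in> Lp_fun M p v"
    and "Lp_norm M p v (\<lambda>y. LINT x|M. indicator E x * f x * k x y) \<le> C * measure M E * \<epsilon>"
proof -
  have C: "0 \<le> C"
    using norm_ge_zero f order.trans by blast
  have E [simp]: "E \<in> sets borel"
    using assms(2) by simp
  define g :: "'g \<Rightarrow> 'g \<Rightarrow> real" where "g x y = indicator E x" for x y
  define h where "h x y = indicator E x * (C * cmod (of_real (v y) * k x y))" for x y
  have [measurable]: "case_prod g \<in> borel_measurable (M \<Otimes>\<^sub>M M)" "case_prod h \<in> borel_measurable (M \<Otimes>\<^sub>M M)"
    unfolding g_def h_def by measurable
  have h_powr: "h x y powr p = indicator E x * C powr p * cmod (of_real (v y) * k x y) powr p" for x y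
    using C by (auto simp: h_def indicator_def powr_mult)
  have inner: "(LINT y|M. h x y powr p) \<le> indicator E x * (C * \<epsilon>) powr p" for x
  proof (cases "x \<in> E")
    case True
    have "(LINT y|M. cmod (of_real (v y) * k x y) powr p) \<le> \<epsilon> powr p"
      using powr_mono2[of p, OF _ _ k(2)[OF True]] Lp_norm_powr[of p M v "k x"] p by simp
    then show ?thesis
      using True C \<open>0 \<le> \<epsilon>\<close> by (simp add: h_powr powr_mult mult_left_mono)
  qed (simp add: h_powr)
  have ind: "integrable M (\<lambda>x. indicator E x * c)" for c :: real
    using fin by (intro integrable_mult_left integrable_real_indicator) auto
  have [measurable]: "(\<lambda>x. LINT y|M. h x y powr p) \<in> borel_measurable M"
    by measurable
  have int_inner: "integrable M (\<lambda>x. LINT y|M. h x y powr p)"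
    by (rule Bochner_Integration.integrable_bound[OF ind[of "(C * \<epsilon>) powr p"]])
       (use inner in \<open>auto intro!: AE_I2\<close>)
  have hint: "integrable (M \<Otimes>\<^sub>M M) (\<lambda>(x, y). h x y powr p)"
  proof (rule P.Fubini_integrable)
    show "AE x in M. integrable M (\<lambda>y. case (x, y) of (x, y) \<Rightarrow> h x y powr p)"
    proof (rule AE_I2)
      fix x show "integrable M (\<lambda>y. case (x, y) of (x, y) \<Rightarrow> h x y powr p)"
        using Lp_fun_integrable[OF k(1), of x] by (cases "x \<in> E") (auto simp: h_powr)
    qed
  qed (use int_inner in auto)
  have bound: "cmod (of_real (v y) * (indicator E x * f x * k x y)) \<le> g x y * h x y" for x y
    using mult_right_mono[OF f[of x], of "\<bar>v y\<bar> * cmod (k x y)"]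
    by (auto simp: g_def h_def indicator_def norm_mult mult_ac)
  have gint: "integrable M (\<lambda>x. g x y powr (p / (p - 1)))"
    and gle: "(LINT x|M. g x y powr (p / (p - 1))) \<le> measure M E" for y
  proof -
    have "(\<lambda>x. g x y powr (p / (p - 1))) = indicator E"
      using p by (auto simp: g_def indicator_def)
    then show "integrable M (\<lambda>x. g x y powr (p / (p - 1)))"
        "(LINT x|M. g x y powr (p / (p - 1))) \<le> measure M E"
      using fin by auto
  qed
  note op = P.kernel_operator_Lp[of p v "\<lambda>x y. indicator E x * f x * k x y" g h "measure M E",
      OF p _ _ _ _ _ _ _ bound gint gle hint]
  show "(\<lambda>y. LINT x|M. indicator E x * f x * k x y) \<in> Lp_fun M p v"
    using C by (intro op) (auto simp: g_def h_def)
  have "Lp_norm M p v (\<lambda>y. LINT x|M. indicator E x * f x * k x y) powr p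
     \<le> measure M E powr (p - 1) * (LINT x|M. LINT y|M. h x y powr p)"
    using C by (intro op) (auto simp: g_def h_def)
  also have "\<dots> \<le> measure M E powr (p - 1) * (LINT x|M. indicator E x * (C * \<epsilon>) powr p)"
    by (intro mult_left_mono integral_mono inner int_inner ind) auto
  also have "\<dots> = measure M E powr (p - 1) * (measure M E * (C * \<epsilon>) powr p)"
    by simp
  also have "\<dots> = (C * measure M E * \<epsilon>) powr p"
  proof (cases "measure M E = 0")
    case False
    then have "measure M E powr (p - 1) * measure M E = measure M E powr p"
      using powr_add[of "measure M E" "p - 1" 1] by (simp add: zero_less_measure_iff)
    then have "measure M E powr (p - 1) * (measure M E * (C * \<epsilon>) powr p) = (measure M E * (C * \<epsilon>)) powr p"
      using C \<open>0 \<le> \<epsilon>\<close> powr_mult[of "measure M E" "C * \<epsilon>" p] by simp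
    then show ?thesis
      by (simp only: mult_ac)
  qed simp
  finally show "Lp_norm M p v (\<lambda>y. LINT x|M. indicator E x * f x * k x y) \<le> C * measure M E * \<epsilon>"
    using p C \<open>0 \<le> \<epsilon>\<close> by (intro Lp_norm_le) (auto simp: Lp_norm_powr)
qed

end

section \<open>The voice transform and the test space\<close>

locale coorbit_setting = haar_group M
  for M :: "'g::{topological_group_add, second_countable_topology, t2_space} measure" +
  fixes \<pi> :: "'g \<Rightarrow> 'h::complex_hilbert_space \<Rightarrow> 'h"
    and u :: 'h
    and w m :: "'g \<Rightarrow> real"
  assumes reproducing: "reproducing_representation M \<pi> u"
    and w: "control_weight w"
    and kernel: "\<And>p. 1 < p \<Longrightarrow> repr_kernel \<pi> u \<in> Lp_fun M p w"
    and m: "moderate_weight w m"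
begin

abbreviation "V \<equiv> voice \<pi> u"
abbreviation "K \<equiv> repr_kernel \<pi> u"
abbreviation "S \<equiv> test_space M \<pi> u w"

text \<open>The seminorms of the test space.\<close>

definition N :: "real \<Rightarrow> 'h \<Rightarrow> real" where
  "N p v = Lp_norm M p w (V v)"

lemma w_measurable [measurable]: "w \<in> borel_measurable M"
  using control_weight_measurable[OF w] .

lemma w_pos: "0 < w x"
  using control_weight_pos[OF w] .

lemma unitary: "unitary_representation \<pi>"
  using reproducing by (simp add: reproducing_representation_def)

lemma pi_plus: "\<pi> (x + y) v = \<pi> x (\<pi> y v)"
  using unitary by (simp add: unitary_representation_def)

lemma cinner_pi: "cinner (\<pi> x v) (\<pi> x v') = cinner v v'"
  using unitary by (simp add: unitary_representation_def)

lemma norm_pi: "norm (\<pi> x v) = norm v"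
proof -
  have "complex_of_real ((norm (\<pi> x v))\<^sup>2) = of_real ((norm v)\<^sup>2)"
    unfolding cinner_self[symmetric] cinner_pi ..
  then show ?thesis
    unfolding of_real_eq_iff by (simp add: power2_eq_iff_nonneg)
qed

lemma kernel_quotient: "K (- x + y) = cinner (\<pi> x u) (\<pi> y u)"
proof -
  have "cinner (\<pi> x u) (\<pi> x (\<pi> (- x + y) u)) = cinner u (\<pi> (- x + y) u)"
    by (rule cinner_pi)
  then show ?thesis
    by (simp add: repr_kernel_def voice_def add.assoc[symmetric] flip: pi_plus)
qed

lemma kernel_symmetric: "cmod (K (- x)) = cmod (K x)"
proof -
  have "\<pi> 0 u = u"
    using unitary by (simp add: unitary_representation_def)
  then have "K (- x) = cnj (K x)"
    using kernel_quotient[of x 0] by (simp add: repr_kernel_def voice_def cinner_commute[of u])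
  then show ?thesis
    by simp
qed

lemma voice_measurable [measurable]: "V v \<in> borel_measurable M"
  using reproducing by (auto simp: reproducing_representation_def Lp_fun_def)

lemma cnj_voice_measurable [measurable]: "(\<lambda>x. cnj (V v x)) \<in> borel_measurable M"
  by (rule borel_measurable_continuous_on[OF _ voice_measurable]) (intro continuous_intros)

lemma kernel_measurable [measurable]: "K \<in> borel_measurable M"
  by (simp add: repr_kernel_def)

lemma voice_bound: "cmod (V v x) \<le> norm v * norm u"
  using cinner_Cauchy_Schwarz[of v "\<pi> x u"] by (simp add: voice_def norm_pi)

lemma voice_add: "V (v + v') = (\<lambda>x. V v x + V v' x)"
  by (simp add: voice_def cinner_add_left fun_eq_iff)

lemma voice_diff: "V (v - v') = (\<lambda>x. V v x - V v' x)"
  by (simp add: voice_def cinner_diff_left fun_eq_iff)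

lemma voice_scale: "V (c *\<^sub>C v) = (\<lambda>x. c * V v x)"
  by (simp add: voice_def cinner_scaleC_left fun_eq_iff)

lemma voice_orbit: "V (\<pi> x u) = (\<lambda>y. K (- x + y))"
  by (simp add: voice_def kernel_quotient fun_eq_iff)

section \<open>The reproducing formula and the seminorms\<close>

lemma voice_square:
  "integrable M (\<lambda>x. (cmod (V v x))\<^sup>2)" "(LINT x|M. (cmod (V v x))\<^sup>2) = (norm v)\<^sup>2"
proof -
  have V2: "V v \<in> Lp_fun M 2 (\<lambda>x. 1)" "Lp_norm M 2 (\<lambda>x. 1) (V v) = norm v"
    using reproducing by (auto simp: reproducing_representation_def)
  show "integrable M (\<lambda>x. (cmod (V v x))\<^sup>2)"
    using V2(1) by (simp add: Lp_fun_def)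
  show "(LINT x|M. (cmod (V v x))\<^sup>2) = (norm v)\<^sup>2"
    using Lp_norm_powr[of 2 M "\<lambda>x. 1" "V v"] V2(2) by simp
qed

text \<open>Polarization: an isometry preserves scalar products.\<close>

lemma voice_isometry:
  "integrable M (\<lambda>x. V v x * cnj (V v' x))" "(LINT x|M. V v x * cnj (V v' x)) = cinner v v'"
proof -
  have bound: "cmod (V v x * cnj (V v' x)) \<le> (cmod (V v x))\<^sup>2 + (cmod (V v' x))\<^sup>2" for x
    using sum_squares_bound[of "cmod (V v x)" "cmod (V v' x)"]
      mult_nonneg_nonneg[OF norm_ge_zero norm_ge_zero, of "V v x" "V v' x"]
    unfolding norm_mult complex_mod_cnj by linarith

  show int: "integrable M (\<lambda>x. V v x * cnj (V v' x))"
    by (rule Bochner_Integration.integrable_bound[OF Bochner_Integration.integrable_add[OF voice_square(1)[of v] voice_square(1)[of v']]])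
       (use bound in \<open>auto simp: abs_of_nonneg\<close>)
  have square: "(cmod (a + c * b))\<^sup>2 = (cmod a)\<^sup>2 + (cmod c)\<^sup>2 * (cmod b)\<^sup>2 + 2 * Re (cnj c * (a * cnj b))"
    for a b c
    unfolding cmod_power2 by (simp add: power2_eq_square algebra_simps)
  have Re_eq: "Re (cnj c * (LINT x|M. V v x * cnj (V v' x))) = Re (cnj c * cinner v v')" for c
  proof -
    have "(norm (v + c *\<^sub>C v'))\<^sup>2 = (LINT x|M. (cmod (V v x + c * V v' x))\<^sup>2)"
      using voice_square(2)[of "v + c *\<^sub>C v'"] by (simp add: voice_add voice_scale)
    also have "\<dots> = (LINT x|M. (cmod (V v x))\<^sup>2 + (cmod c)\<^sup>2 * (cmod (V v' x))\<^sup>2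
        + 2 * Re (cnj c * (V v x * cnj (V v' x))))"
      by (simp only: square)
    also have "\<dots> = (norm v)\<^sup>2 + (cmod c)\<^sup>2 * (norm v')\<^sup>2
        + 2 * (LINT x|M. Re (cnj c * (V v x * cnj (V v' x))))"
      using voice_square integrable_Re[OF integrable_mult_right[OF int, of "cnj c"]]
      by (simp del: times_complex.sel)
    also have "(LINT x|M. Re (cnj c * (V v x * cnj (V v' x)))) = Re (cnj c * (LINT x|M. V v x * cnj (V v' x)))"
      using integral_Re[OF integrable_mult_right[OF int, of "cnj c"]] by (simp del: times_complex.sel)
    finally show ?thesis
      unfolding norm_add_scaleC_square by linarith
  qed
  show "(LINT x|M. V v x * cnj (V v' x)) = cinner v v'"
    using Re_eq[of 1] Re_eq[of \<i>] by (simp add: complex_eq_iff)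
qed

lemma voice_reproducing:
  "integrable M (\<lambda>x. V v x * K (- x + y))" "(LINT x|M. V v x * K (- x + y)) = V v y"
proof -
  have "(\<lambda>x. V v x * K (- x + y)) = (\<lambda>x. V v x * cnj (V (\<pi> y u) x))"
    by (simp add: kernel_quotient voice_def cinner_commute[of "\<pi> y u"])
  then show "integrable M (\<lambda>x. V v x * K (- x + y))" "(LINT x|M. V v x * K (- x + y)) = V v y"
    using voice_isometry[of v "\<pi> y u"] by (simp_all add: voice_def)
qed

lemma test_spaceD: "v \<in> S \<Longrightarrow> 1 < p \<Longrightarrow> V v \<in> Lp_fun M p w"
  by (simp add: test_space_def)

lemma test_space_add: "v \<in> S \<Longrightarrow> v' \<in> S \<Longrightarrow> v + v' \<in> S"
  by (auto simp: test_space_def voice_add intro!: Lp_fun_add)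

lemma test_space_scale: "v \<in> S \<Longrightarrow> c *\<^sub>C v \<in> S"
  by (auto simp: test_space_def voice_scale intro!: Lp_fun_scale)

lemma minus_scaleC: "- v = (- 1) *\<^sub>C (v :: 'h)"
  using scaleC_of_real[of "- 1" v] by simp

lemma test_space_diff: "v \<in> S \<Longrightarrow> v' \<in> S \<Longrightarrow> v - v' \<in> S"
  using test_space_add[of v "- v'"] test_space_scale[of v' "- 1"] by (simp add: minus_scaleC[symmetric])

lemma voice_zero: "V 0 = (\<lambda>x. 0)"
  by (simp add: voice_def[abs_def])

lemma test_space_zero: "0 \<in> S"
  by (simp add: test_space_def voice_zero)

lemma test_space_sum: "(\<And>j. j \<in> J \<Longrightarrow> f j \<in> S) \<Longrightarrow> (\<Sum>j\<in>J. f j) \<in> S"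
  by (induction J rule: infinite_finite_induct) (auto simp: test_space_zero test_space_add)

lemma N_nonneg: "0 \<le> N p v"
  by (simp add: N_def)

lemma N_add: "1 < p \<Longrightarrow> v \<in> S \<Longrightarrow> v' \<in> S \<Longrightarrow> N p (v + v') \<le> N p v + N p v'"
  unfolding N_def voice_add by (intro Lp_norm_triangle test_spaceD w_measurable)

lemma N_scale: "1 < p \<Longrightarrow> N p (c *\<^sub>C v) = cmod c * N p v"
  unfolding N_def voice_scale by (simp add: Lp_norm_scale)

lemma orbit_in_test_space: "\<pi> x u \<in> S"
proof -
  have "(\<lambda>y. K (- x + y)) \<in> Lp_fun M p w" if p: "1 < p" for p
  proof -
    have int: "integrable M (\<lambda>y. w x powr p * cmod (of_real (w (- x + y)) * K (- x + y)) powr p)"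
      using integrable_translation[of "\<lambda>y. cmod (of_real (w y) * K y) powr p" "- x"]
        Lp_fun_integrable[OF kernel[OF p]] by simp
    have le: "cmod (of_real (w y) * K (- x + y)) powr p
        \<le> w x powr p * cmod (of_real (w (- x + y)) * K (- x + y)) powr p" for y
    proof -
      have "cmod (of_real (w y) * K (- x + y)) = w y * cmod (K (- x + y))"
        using w_pos[of y] by (simp add: norm_mult)
      also have "\<dots> \<le> w x * w (- x + y) * cmod (K (- x + y))"
        by (intro mult_right_mono control_weight_quotient[OF w]) simp
      also have "\<dots> = w x * cmod (of_real (w (- x + y)) * K (- x + y))"
        using w_pos[of "- x + y"] by (simp add: norm_mult)
      finally show ?thesis
        using w_pos[of x] p by (simp add: powr_mono2 flip: powr_mult)
    qed
    have "integrable M (\<lambda>y. cmod (of_real (w y) * K (- x + y)) powr p)"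
      by (rule Bochner_Integration.integrable_bound[OF int]) (use le in \<open>auto intro!: AE_I2\<close>)
    then show ?thesis
      by (simp add: Lp_fun_def)
  qed
  then show ?thesis
    by (simp add: test_space_def voice_orbit)
qed

section \<open>Continuity of the orbit in the test space\<close>

lemma kernel_continuous: "continuous_on UNIV K"
proof -
  have "(\<lambda>y. cinner u (\<pi> y u)) \<midarrow>x\<rightarrow> cinner u (\<pi> x u)" for x
  proof (rule Lim_null_comparison[THEN LIM_zero_cancel])
    have "(\<lambda>y. \<pi> y u) \<midarrow>x\<rightarrow> \<pi> x u"
      using unitary by (auto simp: unitary_representation_def continuous_on_def)
    then show "(\<lambda>y. norm u * norm (\<pi> y u - \<pi> x u)) \<midarrow>x\<rightarrow> 0"
      by (intro tendsto_mult_right_zero tendsto_norm_zero LIM_zero)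
    show "\<forall>\<^sub>F y in at x. norm (cinner u (\<pi> y u) - cinner u (\<pi> x u)) \<le> norm u * norm (\<pi> y u - \<pi> x u)"
      unfolding cinner_diff_right[symmetric] by (intro always_eventually allI cinner_Cauchy_Schwarz)
  qed
  then show ?thesis
    by (auto simp: continuous_on_def repr_kernel_def voice_def)
qed

lemma kernel_joint_measurable [measurable]:
  "(\<lambda>(x, y). V (\<pi> x u - v) y) \<in> borel_measurable (M \<Otimes>\<^sub>M M)"
  unfolding voice_diff voice_orbit by measurable

text \<open>Translation is continuous at \<open>K\<close> in \<open>L\<^sub>p\<close> because \<open>K\<close> is continuous. Pointwise convergence of
  the translates is clear, and their norms converge by dominated convergence, applied after a
  translation of the integration variable. By Scheffe's lemma this already gives convergence of the
  \<open>p\<close>-th powers \<open>g\<close> in \<open>L\<^sub>1\<close>; it replaces the dominating function that the differences \<open>h\<close> need not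
  have, since \<open>h \<le> 2\<^sup>p (\<bar>g\<^sub>n - g\<bar> + 2g)\<close>.\<close>

lemma orbit_sequentially_continuous:
  assumes X: "X \<longlonglongrightarrow> x" and p: "1 < p"
  shows "(\<lambda>n. N p (\<pi> (X n) u - \<pi> x u)) \<longlonglongrightarrow> 0"
proof -
  define g where "g z y = cmod (of_real (w y) * K (- z + y)) powr p" for z y
  have g_orbit: "g z = (\<lambda>y. cmod (of_real (w y) * V (\<pi> z u) y) powr p)" for z
    by (simp add: g_def voice_orbit fun_eq_iff)
  have int_g: "integrable M (g z)" for z
    unfolding g_orbit using Lp_fun_integrable[OF test_spaceD[OF orbit_in_test_space p]] .
  have w_cont: "isCont w z" for z
    using w by (simp add: control_weight_def continuous_on_eq_continuous_at)
  have K_cont: "isCont K z" for z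
    using kernel_continuous by (simp add: continuous_on_eq_continuous_at)
  have g_lim: "(\<lambda>n. g (X n) y) \<longlonglongrightarrow> g x y" for y
    unfolding g_def using p
    by (intro tendsto_intros isCont_tendsto_compose[OF K_cont] X tendsto_powr') auto
  \<comment> \<open>After a translation only the weight depends on \<open>n\<close>, and it is dominated through submultiplicativity.\<close>
  define g' where "g' z y = (w (z + y) * cmod (K y)) powr p" for z y
  have g'_trans: "(LINT y|M. g z y) = (LINT y|M. g' z y)" for z
  proof -
    have [measurable]: "g z \<in> borel_measurable M"
      unfolding g_def by measurable
    have "g z (z + y) = g' z y" for y
      using w_pos[of "z + y"] by (simp add: g_def g'_def norm_mult add.assoc[symmetric])
    then show ?thesis
      using integral_translation[of "g z" z] by simp
  qed
  obtain C where C: "\<And>n. w (X n) \<le> C"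
  proof -
    have "Bseq (\<lambda>n. w (X n))"
      using isCont_tendsto_compose[OF w_cont X] by (intro convergent_imp_Bseq convergentI)
    then obtain C where "\<forall>n. norm (w (X n)) \<le> C"
      by (auto elim: BseqE)
    then show thesis
      using that[of C] by (auto simp: abs_le_iff)
  qed
  have g'_lim: "(\<lambda>n. LINT y|M. g' (X n) y) \<longlonglongrightarrow> (LINT y|M. g' x y)"
  proof (rule integral_dominated_convergence)
    show "integrable M (\<lambda>y. C powr p * (cmod (of_real (w y) * K y) powr p))"
      using Lp_fun_integrable[OF kernel[OF p]] by simp
    show "AE y in M. (\<lambda>n. g' (X n) y) \<longlonglongrightarrow> g' x y"
    proof (rule AE_I2)
      fix y
      have "(\<lambda>n. w (X n + y) * cmod (K y)) \<longlonglongrightarrow> w (x + y) * cmod (K y)"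
        by (intro tendsto_intros isCont_tendsto_compose[OF w_cont] X)
      then show "(\<lambda>n. g' (X n) y) \<longlonglongrightarrow> g' x y"
        unfolding g'_def using p less_imp_le[OF w_pos]
        by (intro tendsto_powr' tendsto_const disjI2) auto
    qed
    show "AE y in M. norm (g' (X n) y) \<le> C powr p * (cmod (of_real (w y) * K y) powr p)" for n
    proof (rule AE_I2)
      fix y
      have "w (X n + y) \<le> w (X n) * w y"
        using w by (simp add: control_weight_def)
      also have "\<dots> \<le> C * w y"
        using C[of n] w_pos[of y] by (simp add: mult_right_mono)
      finally have "(w (X n + y) * cmod (K y)) powr p \<le> (C * w y * cmod (K y)) powr p"
        using p w_pos[of "X n + y"] by (intro powr_mono2 mult_right_mono) auto
      then show "norm (g' (X n) y) \<le> C powr p * (cmod (of_real (w y) * K y) powr p)"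
        using w_pos[of y] w_pos[of "X n"] C[of n]
        by (simp add: g'_def norm_mult powr_mult mult.assoc)
    qed
  qed (auto simp: g'_def)
  have [measurable]: "g z \<in> borel_measurable M" for z
    using int_g by (rule borel_measurable_integrable)
  have g_nonneg: "0 \<le> g z y" for z y
    by (simp add: g_def)
  have nn_g: "(\<integral>\<^sup>+ y. norm (g z y) \<partial>M) = ennreal (LINT y|M. g z y)" for z
    using nn_integral_eq_integral[OF int_g] g_nonneg by simp
  have "(\<lambda>n. \<integral>\<^sup>+ y. norm (g (X n) y - g x y) \<partial>M) \<longlonglongrightarrow> 0"
  proof (rule Scheffe_lemma1[OF int_g int_g])
    show "AE y in M. (\<lambda>n. g (X n) y) \<longlonglongrightarrow> g x y"
      using g_lim by simp
    have "(\<lambda>n. ennreal (LINT y|M. g (X n) y)) \<longlonglongrightarrow> ennreal (LINT y|M. g x y)"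
      unfolding g'_trans by (intro tendsto_ennrealI g'_lim)
    then show "limsup (\<lambda>n. \<integral>\<^sup>+ y. norm (g (X n) y) \<partial>M) \<le> (\<integral>\<^sup>+ y. norm (g x y) \<partial>M)"
      unfolding nn_g using lim_imp_Limsup[OF sequentially_bot] by (metis order_refl)
  qed
  moreover have nn_diff: "(\<integral>\<^sup>+ y. norm (g (X n) y - g x y) \<partial>M) = ennreal (LINT y|M. \<bar>g (X n) y - g x y\<bar>)" for n
    using nn_integral_eq_integral[OF integrable_norm[OF Bochner_Integration.integrable_diff[OF int_g int_g]]] by simp
  ultimately have "(\<lambda>n. ennreal (LINT y|M. \<bar>g (X n) y - g x y\<bar>)) \<longlonglongrightarrow> ennreal 0"
    by simp
  then have g_L1: "(\<lambda>n. LINT y|M. \<bar>g (X n) y - g x y\<bar>) \<longlonglongrightarrow> 0"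
    by (subst (asm) tendsto_ennreal_iff) auto
  define h where "h n y = cmod (of_real (w y) * (K (- X n + y) - K (- x + y))) powr p" for n y
  \<comment> \<open>The part of \<open>h\<close> below the fixed integrable function \<open>2\<^sup>p \<cdot> 2g\<close> tends to \<open>0\<close> by dominated convergence;
    the excess is at most \<open>2\<^sup>p \<bar>g\<^sub>n - g\<bar>\<close>.\<close>
  define b where "b n y = min (h n y) (2 powr p * (2 * g x y))" for n y
  have [measurable]: "h n \<in> borel_measurable M" for n
    unfolding h_def by measurable
  have [measurable]: "b n \<in> borel_measurable M" for n
    unfolding b_def by measurable
  have h_le: "h n y \<le> 2 powr p * \<bar>g (X n) y - g x y\<bar> + b n y" for n y
  proof -
    define \<alpha> where "\<alpha> = cmod (of_real (w y) * K (- X n + y))"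
    define \<beta> where "\<beta> = cmod (of_real (w y) * K (- x + y))"
    have "cmod (of_real (w y) * (K (- X n + y) - K (- x + y))) \<le> \<alpha> + \<beta>"
      unfolding \<alpha>_def \<beta>_def right_diff_distrib by (rule norm_triangle_ineq4)
    also have "\<dots> \<le> 2 * max \<alpha> \<beta>"
      by simp
    finally have "h n y \<le> (2 * max \<alpha> \<beta>) powr p"
      unfolding h_def using p by (intro powr_mono2) auto
    also have "\<dots> = 2 powr p * (max \<alpha> \<beta>) powr p"
      by (rule powr_mult)
    also have "(max \<alpha> \<beta>) powr p \<le> g (X n) y + g x y"
      by (auto simp: max_def g_def \<alpha>_def \<beta>_def)
    also have "\<dots> \<le> \<bar>g (X n) y - g x y\<bar> + 2 * g x y"
      by simp
    finally have *: "h n y \<le> 2 powr p * (\<bar>g (X n) y - g x y\<bar> + 2 * g x y)"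
      by simp
    have "0 \<le> 2 powr p * \<bar>g (X n) y - g x y\<bar>"
      by simp
    with * show ?thesis
      unfolding b_def distrib_left by linarith
  qed
  have h_nonneg: "0 \<le> h n y" and b_nonneg: "0 \<le> b n y" for n y
    using g_nonneg by (auto simp: h_def b_def)
  have int_b: "integrable M (b n)" for n
    by (rule Bochner_Integration.integrable_bound[where f = "\<lambda>y. 2 powr p * (2 * g x y)"])
       (use int_g b_nonneg g_nonneg in \<open>auto simp: b_def\<close>)
  have b_lim: "(\<lambda>n. LINT y|M. b n y) \<longlonglongrightarrow> (LINT y|M. 0)"
  proof (rule integral_dominated_convergence)
    show "integrable M (\<lambda>y. 2 powr p * (2 * g x y))"
      using int_g by simp
    show "AE y in M. (\<lambda>n. b n y) \<longlonglongrightarrow> 0"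
    proof (rule AE_I2)
      fix y
      have "(\<lambda>n. K (- X n + y)) \<longlonglongrightarrow> K (- x + y)"
        by (intro isCont_tendsto_compose[OF K_cont] tendsto_intros X)
      then have "(\<lambda>n. of_real (w y) * (K (- X n + y) - K (- x + y))) \<longlonglongrightarrow> 0"
        by (intro tendsto_mult_right_zero LIM_zero)
      then have "(\<lambda>n. h n y) \<longlonglongrightarrow> 0 powr p"
        unfolding h_def using p by (intro tendsto_powr' tendsto_norm_zero tendsto_const) auto
      then have "(\<lambda>n. h n y) \<longlonglongrightarrow> 0"
        using p by simp
      then show "(\<lambda>n. b n y) \<longlonglongrightarrow> 0"
        using tendsto_sandwich[of "\<lambda>_. 0" "\<lambda>n. b n y" sequentially "\<lambda>n. h n y" 0] b_nonneg
        by (simp add: b_def)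
    qed
    show "AE y in M. norm (b n y) \<le> 2 powr p * (2 * g x y)" for n
      using b_nonneg[of n] by (auto simp: b_def)
  qed auto
  have int_h: "integrable M (h n)" for n
    by (rule Bochner_Integration.integrable_bound[where f = "\<lambda>y. 2 powr p * \<bar>g (X n) y - g x y\<bar> + b n y"])
       (use int_g int_b h_nonneg h_le in \<open>auto intro!: AE_I2 order.trans[OF h_le]\<close>)
  have "(\<lambda>n. LINT y|M. h n y) \<longlonglongrightarrow> 0"
  proof (rule tendsto_sandwich[OF _ _ tendsto_const])
    show "\<forall>\<^sub>F n in sequentially. 0 \<le> (LINT y|M. h n y)"
      by (simp add: h_nonneg)
    show "\<forall>\<^sub>F n in sequentially. (LINT y|M. h n y)
        \<le> 2 powr p * (LINT y|M. \<bar>g (X n) y - g x y\<bar>) + (LINT y|M. b n y)"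
    proof (intro always_eventually allI)
      fix n
      have "(LINT y|M. h n y) \<le> (LINT y|M. 2 powr p * \<bar>g (X n) y - g x y\<bar> + b n y)"
        using int_h int_g int_b h_le by (intro integral_mono) auto
      then show "(LINT y|M. h n y) \<le> 2 powr p * (LINT y|M. \<bar>g (X n) y - g x y\<bar>) + (LINT y|M. b n y)"
        using int_g int_b by simp
    qed
    show "(\<lambda>n. 2 powr p * (LINT y|M. \<bar>g (X n) y - g x y\<bar>) + (LINT y|M. b n y)) \<longlonglongrightarrow> 0"
      using tendsto_add[OF tendsto_mult_right_zero[OF g_L1, of "2 powr p"] b_lim] by simp
  qed
  then have "(\<lambda>n. (LINT y|M. h n y) powr (1 / p)) \<longlonglongrightarrow> 0 powr (1 / p)"
    using p by (intro tendsto_powr' tendsto_const) (auto simp: h_nonneg)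
  then show ?thesis
    unfolding N_def Lp_norm_def voice_diff voice_orbit h_def using p by simp
qed

lemma orbit_continuous:
  assumes "1 < p" "0 < \<epsilon>"
  shows "\<forall>\<^sub>F y in nhds x. N p (\<pi> y u - \<pi> x u) < \<epsilon>"
  unfolding eventually_nhds_iff_sequentially
  using order_tendstoD(2)[OF orbit_sequentially_continuous] assms by blast


section \<open>Functionals on the test space\<close>

text \<open>The generating sets are balls around arbitrary centres; the triangle inequality recentres
  them, so that the neighbourhoods of a point are governed by the seminorms as in any locally convex
  space.\<close>

lemma test_topology_neighbourhood:
  assumes "openin (test_topology M \<pi> u w) U" "v\<^sub>0 \<in> U"
  shows "\<exists>P \<delta>. finite P \<and> P \<subseteq> {1<..} \<and> 0 < \<delta> \<and> (\<forall>v\<in>S. (\<forall>p\<in>P. N p (v - v\<^sub>0) < \<delta>) \<longrightarrow> v \<in> U)"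
proof -
  have "generate_topology_on {{v \<in> S. Lp_norm M p w (V (v - v\<^sub>0)) < \<epsilon>} | v\<^sub>0 p \<epsilon>.
          v\<^sub>0 \<in> S \<and> 1 < p \<and> 0 < \<epsilon>} U"
    using assms(1) unfolding test_topology_def by (rule openin_topology_generated_by)
  then show ?thesis
    using assms(2)
  proof (induction arbitrary: v\<^sub>0 rule: generate_topology_on.induct)
    case Empty
    then show ?case by simp
  next
    case (Int A B)
    obtain P \<delta> where A: "finite P" "P \<subseteq> {1<..}" "0 < \<delta>" "\<forall>v\<in>S. (\<forall>p\<in>P. N p (v - v\<^sub>0) < \<delta>) \<longrightarrow> v \<in> A"
      using Int.IH(1)[of v\<^sub>0] Int.prems by auto
    obtain Q \<eta> where B: "finite Q" "Q \<subseteq> {1<..}" "0 < \<eta>" "\<forall>v\<in>S. (\<forall>p\<in>Q. N p (v - v\<^sub>0) < \<eta>) \<longrightarrow> v \<in> B"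
      using Int.IH(2)[of v\<^sub>0] Int.prems by auto
    show ?case
      using A B by (intro exI[of _ "P \<union> Q"] exI[of _ "min \<delta> \<eta>"]) auto
  next
    case (UN \<U>)
    then obtain A where A: "A \<in> \<U>" "v\<^sub>0 \<in> A"
      by auto
    obtain P \<delta> where "finite P" "P \<subseteq> {1<..}" "0 < \<delta>" "\<forall>v\<in>S. (\<forall>p\<in>P. N p (v - v\<^sub>0) < \<delta>) \<longrightarrow> v \<in> A"
      using UN.IH[OF A] by blast
    then show ?case
      using A by (intro exI[of _ P] exI[of _ \<delta>]) blast
  next
    case (Basis A)
    then obtain v\<^sub>1 p \<epsilon> where A: "A = {v \<in> S. N p (v - v\<^sub>1) < \<epsilon>}" "v\<^sub>1 \<in> S" "1 < p"
      by (auto simp: N_def)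
    have "v \<in> A" if "v \<in> S" "N p (v - v\<^sub>0) < \<epsilon> - N p (v\<^sub>0 - v\<^sub>1)" for v
      using N_add[OF A(3), of "v - v\<^sub>0" "v\<^sub>0 - v\<^sub>1"] that A Basis by (auto simp: test_space_diff)
    then show ?case
      using A Basis by (intro exI[of _ "{p}"] exI[of _ "\<epsilon> - N p (v\<^sub>0 - v\<^sub>1)"]) auto
  qed
qed

lemma topspace_test_topology: "topspace (test_topology M \<pi> u w) = S"
proof -
  define \<B> where "\<B> = {{v \<in> S. Lp_norm M p w (V (v - v\<^sub>0)) < \<epsilon>} | v\<^sub>0 p \<epsilon>. v\<^sub>0 \<in> S \<and> 1 < p \<and> 0 < \<epsilon>}"
  have "\<Union>\<B> \<subseteq> S"
    unfolding \<B>_def by blast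
  moreover have "v \<in> \<Union>\<B>" if v: "v \<in> S" for v
  proof (rule UnionI)
    show "{v' \<in> S. Lp_norm M 2 w (V (v' - v)) < 1} \<in> \<B>"
      unfolding \<B>_def mem_Collect_eq using v by (intro exI[of _ v] exI[of _ 2] exI[of _ 1]) simp
    show "v \<in> {v' \<in> S. Lp_norm M 2 w (V (v' - v)) < 1}"
      using v by (simp add: voice_zero)
  qed
  ultimately show ?thesis
    unfolding test_topology_def topology_generated_by_topspace \<B>_def[symmetric] by blast
qed

lemma antidual_add: "T \<in> antidual_test_space M \<pi> u w \<Longrightarrow> v \<in> S \<Longrightarrow> v' \<in> S \<Longrightarrow> T (v + v') = T v + T v'"
  by (simp add: antidual_test_space_def)

lemma antidual_scale: "T \<in> antidual_test_space M \<pi> u w \<Longrightarrow> v \<in> S \<Longrightarrow> T (c *\<^sub>C v) = cnj c * T v"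
  by (simp add: antidual_test_space_def)

lemma antidual_zero: "T \<in> antidual_test_space M \<pi> u w \<Longrightarrow> T 0 = 0"
  using antidual_add[of T 0 0] by (simp add: test_space_zero)

lemma antidual_diff:
  assumes "T \<in> antidual_test_space M \<pi> u w" "v \<in> S" "v' \<in> S"
  shows "T (v - v') = T v - T v'"
  using antidual_add[OF assms(1) test_space_diff[OF assms(2,3)] assms(3)] by simp

lemma antidual_sum:
  assumes "T \<in> antidual_test_space M \<pi> u w" "\<And>j. j \<in> J \<Longrightarrow> f j \<in> S"
  shows "T (\<Sum>j\<in>J. f j) = (\<Sum>j\<in>J. T (f j))"
  using assms(2)
  by (induction J rule: infinite_finite_induct)
     (auto simp: antidual_zero[OF assms(1)] antidual_add[OF assms(1)] test_space_sum)

lemma antidual_bounded: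
  assumes T: "T \<in> antidual_test_space M \<pi> u w"
  obtains P c where "finite P" "P \<subseteq> {1<..}" "0 \<le> c" "\<And>v. v \<in> S \<Longrightarrow> cmod (T v) \<le> c * (\<Sum>p\<in>P. N p v)"
proof -
  have "openin (test_topology M \<pi> u w) {v \<in> topspace (test_topology M \<pi> u w). T v \<in> ball 0 1}"
    using T by (intro openin_continuous_map_preimage[of _ euclidean]) (auto simp: antidual_test_space_def)
  moreover have "0 \<in> {v \<in> topspace (test_topology M \<pi> u w). T v \<in> ball 0 1}"
    by (simp add: topspace_test_topology test_space_zero antidual_zero[OF T])
  ultimately obtain P \<delta> where P: "finite P" "P \<subseteq> {1<..}" "0 < \<delta>"
    and small: "\<And>v. v \<in> S \<Longrightarrow> (\<And>p. p \<in> P \<Longrightarrow> N p v < \<delta>) \<Longrightarrow> cmod (T v) < 1"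
    using test_topology_neighbourhood[of "{v \<in> topspace (test_topology M \<pi> u w). T v \<in> ball 0 1}" 0]
    by (fastforce simp: topspace_test_topology)
  have "cmod (T v) \<le> (1 / \<delta>) * (\<Sum>p\<in>P. N p v)" if v: "v \<in> S" for v
  proof -
    have "cmod (T v) * \<delta> \<le> t" if t: "(\<Sum>p\<in>P. N p v) < t" for t
    proof -
      have "0 < t"
        using t sum_nonneg[of P "\<lambda>p. N p v"] N_nonneg by (meson le_less_trans)
      define c where "c = complex_of_real (\<delta> / t)"
      have c: "cmod c = \<delta> / t"
        using \<open>0 < t\<close> P unfolding c_def norm_of_real by simp
      have "N p (c *\<^sub>C v) < \<delta>" if "p \<in> P" for p
      proof -
        have "N p v < t"
          using t member_le_sum[of p P "\<lambda>p. N p v"] that P N_nonneg by simp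
        then show ?thesis
          using that P \<open>0 < t\<close> by (subst N_scale) (auto simp: c field_simps)
      qed
      then have "cmod (T (c *\<^sub>C v)) < 1"
        by (intro small test_space_scale v)
      then show ?thesis
        using \<open>0 < t\<close> by (simp add: antidual_scale[OF T v] norm_mult c field_simps)
    qed
    then have "cmod (T v) * \<delta> \<le> (\<Sum>p\<in>P. N p v)"
      by (rule dense_ge)
    then show ?thesis
      using P by (simp add: field_simps)
  qed
  then show thesis
    using that[of P "1 / \<delta>"] P by auto
qed

section \<open>Approximation by finite combinations of orbit points\<close>

text \<open>By continuity and second countability, countably many open sets on which the orbit stays
  \<open>\<epsilon>\<close>-close to one of its points cover the group; the cover is then made disjoint.\<close>

lemma orbit_partition:
  assumes A [measurable]: "A \<in> sets M" and P: "finite P" "P \<subseteq> {1<..}" and \<epsilon>: "0 < \<epsilon>"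
  obtains E :: "nat \<Rightarrow> 'g set" and x :: "nat \<Rightarrow> 'g"
  where "disjoint_family E" "range E \<subseteq> sets M" "(\<Union>j. E j) = A"
    "\<forall>j. \<forall>y\<in>E j. \<forall>p\<in>P. N p (\<pi> y u - \<pi> (x j) u) < \<epsilon>"
proof -
  define \<U> where "\<U> = {U. open U \<and> (\<exists>x. \<forall>y\<in>U. \<forall>p\<in>P. N p (\<pi> y u - \<pi> x u) < \<epsilon>)}"
  obtain \<V> where \<V>: "\<V> \<subseteq> \<U>" "countable \<V>" "\<Union>\<V> = \<Union>\<U>"
    using Lindelof[of \<U>] by (auto simp: \<U>_def)
  have cover: "x \<in> \<Union>\<U>" for x
  proof -
    have "\<forall>\<^sub>F y in nhds x. \<forall>p\<in>P. N p (\<pi> y u - \<pi> x u) < \<epsilon>"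
      using P \<epsilon> orbit_continuous by (intro eventually_ball_finite) auto
    then show ?thesis
      by (auto simp: eventually_nhds \<U>_def)
  qed
  then have "\<V> \<noteq> {}"
    using \<V> by auto
  define W where "W = from_nat_into \<V>"
  have W: "W j \<in> \<U>" for j
    using from_nat_into[OF \<open>\<V> \<noteq> {}\<close>] \<V> by (auto simp: W_def)
  have UN_W: "(\<Union>j. W j) = UNIV"
    using range_from_nat_into[OF \<open>\<V> \<noteq> {}\<close> \<V>(2)] \<V>(3) cover by (auto simp: W_def)
  obtain x where x: "\<And>j y p. y \<in> W j \<Longrightarrow> p \<in> P \<Longrightarrow> N p (\<pi> y u - \<pi> (x j) u) < \<epsilon>"
    using W unfolding \<U>_def mem_Collect_eq by metis
  have W_sets: "W j \<in> sets M" for j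
    using W[of j] by (simp add: \<U>_def)
  show thesis
  proof
    show "disjoint_family (\<lambda>j. A \<inter> disjointed W j)"
      using disjoint_family_disjointed[of W] by (auto simp: disjoint_family_on_def)
    show "range (\<lambda>j. A \<inter> disjointed W j) \<subseteq> sets M"
      using sets.range_disjointed_sets[of W M] W_sets A by blast
    show "(\<Union>j. A \<inter> disjointed W j) = A"
      using UN_disjointed_eq[of W] UN_W by auto
    show "\<forall>j. \<forall>y\<in>A \<inter> disjointed W j. \<forall>p\<in>P. N p (\<pi> y u - \<pi> (x j) u) < \<epsilon>"
      using x disjointed_subset[of W] by blast
  qed
qed

lemma Lp_norm_decreasing_restriction:
  assumes [measurable]: "\<And>n. D n \<in> sets M" and dec: "decseq D"
    and q: "1 < q" and f: "f \<in> Lp_fun M q w"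
  shows "(\<lambda>n. Lp_norm M q w (\<lambda>x. indicator (D n) x * f x)) \<longlonglongrightarrow> Lp_norm M q w (\<lambda>x. indicator (\<Inter>n. D n) x * f x)"
proof -
  define F where "F x = cmod (of_real (w x) * f x) powr q" for x
  have eq: "Lp_norm M q w (\<lambda>x. indicator B x * f x) = (LINT x:B|M. F x) powr (1/q)" for B
  proof -
    have "cmod (of_real (w x) * (indicator B x * f x)) powr q = indicator B x *\<^sub>R F x" for x
      using q by (simp add: F_def indicator_def)
    then show ?thesis
      by (simp add: Lp_norm_def set_lebesgue_integral_def)
  qed
  have F: "integrable M F"
    using f by (simp add: F_def[abs_def] Lp_fun_def)
  have "(\<lambda>n. LINT x:D n|M. F x) \<longlonglongrightarrow> (LINT x:(\<Inter>n. D n)|M. F x)"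
    by (rule set_integral_cont_down[OF assms(1) dec])
       (use integrable_mult_indicator[OF assms(1) F] in \<open>simp add: set_integrable_def\<close>)
  moreover have "0 \<le> (LINT x:D n|M. F x)" for n
    by (auto simp: set_lebesgue_integral_def F_def intro!: integral_nonneg_AE)
  ultimately show ?thesis
    unfolding eq using q by (intro tendsto_powr' tendsto_const) auto
qed

lemma Lp_fun_restrict:
  assumes [measurable]: "D \<in> sets M" and f: "f \<in> Lp_fun M q w" and q: "1 < q"
  shows "(\<lambda>x. indicator D x * f x) \<in> Lp_fun M q w"
proof -
  have [measurable]: "f \<in> borel_measurable M"
    using f by (simp add: Lp_fun_def)
  have eq: "(\<lambda>x. cmod (of_real (w x) * (indicator D x * f x)) powr q)
      = (\<lambda>x. indicator D x *\<^sub>R (cmod (of_real (w x) * f x) powr q))"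
    using q by (auto simp: indicator_def)
  have "integrable M (\<lambda>x. indicator D x *\<^sub>R (cmod (of_real (w x) * f x) powr q))"
    using f by (intro integrable_mult_indicator assms(1)) (simp add: Lp_fun_def)
  then show ?thesis
    unfolding Lp_fun_def mem_Collect_eq eq by simp
qed

text \<open>By Young's inequality the first condition bounds, in the \<open>p\<close>-th seminorm, what the set \<open>D\<close>
  contributes to the reproducing integral \<open>V v * K\<close>; note that \<open>N q u\<close> is the norm of \<open>K\<close>.\<close>

definition negligible :: "real set \<Rightarrow> 'h \<Rightarrow> ('g \<Rightarrow> complex) \<Rightarrow> real \<Rightarrow> 'g set \<Rightarrow> bool" where
  "negligible P v g e D \<longleftrightarrow>
     (\<forall>p\<in>P. Lp_norm M (2 * p / (p + 1)) w (\<lambda>x. indicator D x * V v x) * N (2 * p / (p + 1)) u < e) \<and>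
     cmod (LINT x:D|M. g x) < e"

lemma exponent_gt_1: "1 < p \<Longrightarrow> 1 < 2 * p / (p + 1)" for p :: real
  by simp

lemma negligible_decreasing:
  assumes D: "\<And>n. D n \<in> sets M" "decseq D" and lim: "negligible P v g e (\<Inter>n. D n)"
    and v: "v \<in> S" and P: "finite P" "P \<subseteq> {1<..}" and g: "integrable M g"
  obtains n where "negligible P v g e (D n)"
proof -
  have "\<forall>\<^sub>F n in sequentially. Lp_norm M (2 * p / (p + 1)) w (\<lambda>x. indicator (D n) x * V v x)
      * N (2 * p / (p + 1)) u < e" if p: "p \<in> P" for p
  proof (rule order_tendstoD(2))
    have "1 < 2 * p / (p + 1)"
      using p P by (intro exponent_gt_1) auto
    then show "(\<lambda>n. Lp_norm M (2 * p / (p + 1)) w (\<lambda>x. indicator (D n) x * V v x) * N (2 * p / (p + 1)) u)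
      \<longlonglongrightarrow> Lp_norm M (2 * p / (p + 1)) w (\<lambda>x. indicator (\<Inter>n. D n) x * V v x) * N (2 * p / (p + 1)) u"
      by (intro tendsto_mult_right Lp_norm_decreasing_restriction D test_spaceD v)
    show "Lp_norm M (2 * p / (p + 1)) w (\<lambda>x. indicator (\<Inter>n. D n) x * V v x) * N (2 * p / (p + 1)) u < e"
      using lim p by (simp add: negligible_def)
  qed
  then have "\<forall>\<^sub>F n in sequentially. \<forall>p\<in>P. Lp_norm M (2 * p / (p + 1)) w (\<lambda>x. indicator (D n) x * V v x)
      * N (2 * p / (p + 1)) u < e"
    using P by (intro eventually_ball_finite) auto
  moreover have "\<forall>\<^sub>F n in sequentially. cmod (LINT x:D n|M. g x) < e"
  proof (rule order_tendstoD(2))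
    show "(\<lambda>n. cmod (LINT x:D n|M. g x)) \<longlonglongrightarrow> cmod (LINT x:(\<Inter>n. D n)|M. g x)"
      by (intro tendsto_norm set_integral_cont_down[OF D])
         (use integrable_mult_indicator[OF D(1) g] in \<open>simp add: set_integrable_def\<close>)
    show "cmod (LINT x:(\<Inter>n. D n)|M. g x) < e"
      using lim by (simp add: negligible_def)
  qed
  ultimately have "\<forall>\<^sub>F n in sequentially. negligible P v g e (D n)"
    unfolding negligible_def by (rule eventually_conj)
  then show thesis
    using that by (auto simp: eventually_sequentially)
qed

lemma integrable_restrict:
  fixes f :: "'g \<Rightarrow> complex"
  assumes "B \<in> sets M" "integrable M f"
  shows "integrable M (\<lambda>y. indicator B y * f y)"
proof -
  have "(\<lambda>y. indicator B y * f y) = (\<lambda>y. indicator B y *\<^sub>R f y)"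
    by (auto simp: indicator_def)
  then show ?thesis
    using integrable_mult_indicator[OF assms] by simp
qed

text \<open>The error of replacing \<open>\<pi>(x)u\<close> by one vector \<open>v'\<close>, such as an orbit point, in the part of the
  reproducing integral over \<open>E\<close>.\<close>

lemma block_error:
  assumes [measurable]: "E \<in> sets M" and fin: "emeasure M E < \<infinity>" and p: "1 < p" and \<epsilon>: "0 \<le> \<epsilon>"
    and close: "\<And>y. y \<in> E \<Longrightarrow> N p (\<pi> y u - v') \<le> \<epsilon>" and v': "v' \<in> S"
  shows "(\<lambda>y. LINT x|M. indicator E x * V v x * V (\<pi> x u - v') y) \<in> Lp_fun M p w"
    and "Lp_norm M p w (\<lambda>y. LINT x|M. indicator E x * V v x * V (\<pi> x u - v') y)
           \<le> norm v * norm u * measure M E * \<epsilon>"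
  using integral_finite_measure_Lp[of w E "V v" "\<lambda>x. V (\<pi> x u - v')" p "norm v * norm u" \<epsilon>]
    assms voice_bound[of v] test_spaceD[OF test_space_diff[OF orbit_in_test_space v'] p]
  by (auto simp: N_def)

text \<open>The discretized reproducing formula. The bound on \<open>\<epsilon> \<Sum>\<^sub>j \<mu>(E\<^sub>j)\<close> is recorded because the same partition
  is used once more in the reconstruction of functionals, where the oscillation of \<open>T(\<pi>(x)u)\<close> on the
  sets \<open>E\<^sub>j\<close>, which is of order \<open>\<epsilon>\<close>, has to be integrated; there \<open>g\<close> is the integrand of the
  reconstruction formula.\<close>

lemma approximation:
  assumes v: "v \<in> S" and P: "finite P" "P \<subseteq> {1<..}" and g: "integrable M g" and e: "0 < e"
  obtains n and E :: "nat \<Rightarrow> 'g set" and x :: "nat \<Rightarrow> 'g" and \<epsilon>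
  where "\<forall>j. E j \<in> sets M \<and> emeasure M (E j) < \<infinity>"
    "\<forall>j. \<forall>y\<in>E j. \<forall>p\<in>P. N p (\<pi> y u - \<pi> (x j) u) \<le> \<epsilon>"
    "0 \<le> \<epsilon>" "\<epsilon> * (\<Sum>j<n. measure M (E j)) \<le> e"
    "\<forall>p\<in>P. N p (v - (\<Sum>j<n. (LINT y:E j|M. V v y) *\<^sub>C \<pi> (x j) u)) \<le> e + norm v * norm u * e"
    "cmod ((LINT y|M. g y) - (\<Sum>j<n. LINT y:E j|M. g y)) \<le> e"
proof -
  obtain A :: "nat \<Rightarrow> 'g set" where A: "range A \<subseteq> sets M" "(\<Union>i. A i) = space M"
      "\<And>i. emeasure M (A i) \<noteq> \<infinity>" "incseq A"
    using sigma_finite_incseq by metis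
  have A_sets [measurable]: "A i \<in> sets M" for i
    using A(1) by auto
  have "negligible P v g e (\<Inter>i. - A i)"
    using A(2) e by (simp add: negligible_def set_lebesgue_integral_def flip: Compl_UN)
  moreover have "- A i \<in> sets M" for i
    using sets.compl_sets[OF A_sets] by (simp add: Compl_eq_Diff_UNIV)
  moreover have "decseq (\<lambda>i. - A i)"
    using A(4) by (simp add: decseq_def incseq_def)
  ultimately obtain i where i: "negligible P v g e (- A i)"
    using negligible_decreasing[of "\<lambda>i. - A i", OF _ _ _ v P g] by metis
  \<comment> \<open>The set \<open>A i\<close> is fixed before the oscillation bound \<open>\<epsilon>\<close>, which has to compensate its measure; only then
    is the partition chosen and cut off at a finite stage \<open>n\<close>.\<close>
  define \<epsilon> where "\<epsilon> = e / (1 + measure M (A i))"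
  have \<epsilon>: "0 < \<epsilon>"
    using e by (simp add: \<epsilon>_def add_pos_nonneg)
  obtain E :: "nat \<Rightarrow> 'g set" and x where Ex: "disjoint_family E" "range E \<subseteq> sets M" "(\<Union>j. E j) = A i"
      "\<forall>j. \<forall>y\<in>E j. \<forall>p\<in>P. N p (\<pi> y u - \<pi> (x j) u) < \<epsilon>"
    using orbit_partition[OF A_sets[of i] P \<epsilon>] by metis
  have E: "disjoint_family E" "\<And>j. E j \<in> sets M" "(\<Union>j. E j) = A i"
    and close: "\<And>j y p. y \<in> E j \<Longrightarrow> p \<in> P \<Longrightarrow> N p (\<pi> y u - \<pi> (x j) u) < \<epsilon>"
    using Ex by blast+
  note [measurable] = E(2)
  have E_fin: "emeasure M (E j) < \<infinity>" for j
    using emeasure_mono[of "E j" "A i" M] E(3) A(3)[of i] A_sets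
    by (metis UNIV_I UN_upper infinity_ennreal_def order_le_less_trans top.not_eq_extremum)
  define D where "D n = - (\<Union>j<n. E j)" for n
  have D_sets [measurable]: "D n \<in> sets M" for n
    unfolding D_def Compl_eq_Diff_UNIV space_M[symmetric] by measurable
  have "(\<Inter>n. D n) = - A i"
    unfolding E(3)[symmetric] D_def by auto
  moreover have "decseq D"
    by (auto simp: decseq_def D_def)
  ultimately obtain n where n: "negligible P v g e (D n)"
    using negligible_decreasing[where D = D and e = e, OF D_sets _ _ v P g] i by metis
  have partition: "f y = indicator (D n) y * f y + (\<Sum>j<n. indicator (E j) y * f y)" for f :: "'g \<Rightarrow> complex" and y
  proof -
    have "indicator (\<Union>j<n. E j) y = (\<Sum>j<n. indicator (E j) y :: complex)"
      using E(1) by (intro indicator_UN_disjoint) (auto simp: disjoint_family_on_def)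
    moreover have "indicator (D n) y + indicator (\<Union>j<n. E j) y = (1 :: complex)"
      by (auto simp: D_def indicator_def)
    ultimately have "(indicator (D n) y + (\<Sum>j<n. indicator (E j) y)) * f y = 1 * f y"
      by simp
    then show ?thesis
      by (simp add: distrib_right sum_distrib_right)
  qed
  have integral_partition: "(LINT y|M. f y) = (LINT y|M. indicator (D n) y * f y) + (\<Sum>j<n. LINT y|M. indicator (E j) y * f y)"
    if f: "integrable M f" for f :: "'g \<Rightarrow> complex"
  proof -
    note ind = integrable_restrict[OF _ f]
    have "(LINT y|M. f y) = (LINT y|M. indicator (D n) y * f y + (\<Sum>j<n. indicator (E j) y * f y))"
      using partition by (intro Bochner_Integration.integral_cong) auto
    also have "\<dots> = (LINT y|M. indicator (D n) y * f y) + (LINT y|M. (\<Sum>j<n. indicator (E j) y * f y))"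
      by (intro Bochner_Integration.integral_add Bochner_Integration.integrable_sum ind D_sets E(2))
    also have "(LINT y|M. (\<Sum>j<n. indicator (E j) y * f y)) = (\<Sum>j<n. LINT y|M. indicator (E j) y * f y)"
      by (intro Bochner_Integration.integral_sum ind E(2))
    finally show ?thesis .
  qed
  have LINT_ind: "(LINT y:B|M. f y) = (LINT y|M. indicator B y * f y)" for B and f :: "'g \<Rightarrow> complex"
    unfolding set_lebesgue_integral_def by (intro Bochner_Integration.integral_cong) (auto simp: indicator_def)
  define a where "a j = (LINT y:E j|M. V v y)" for j
  define r where "r j y = (LINT z|M. indicator (E j) z * V v z * V (\<pi> z u - \<pi> (x j) u) y)" for j y
  define t where "t = convolution M (\<lambda>z. indicator (D n) z * V v z) K"
  have error: "V (v - (\<Sum>j<n. a j *\<^sub>C \<pi> (x j) u)) y = t y + (\<Sum>j<n. r j y)" for y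
  proof -
    have int_E: "integrable M (\<lambda>z. indicator (E j) z * V v z)" for j
    proof (rule Bochner_Integration.integrable_bound)
      show "integrable M (\<lambda>z. indicator (E j) z * (norm v * norm u))"
        using E_fin E(2) by (intro integrable_mult_left integrable_real_indicator) auto
      show "AE z in M. norm (indicator (E j) z * V v z) \<le> norm (indicator (E j) z * (norm v * norm u))"
        using voice_bound[of v] by (auto simp: indicator_def)
    qed measurable
    have int_EK: "integrable M (\<lambda>z. indicator (E j) z * (V v z * K (- z + y)))" for j
      by (rule integrable_restrict[OF E(2) voice_reproducing(1)])
    have r_eq: "r j y = (LINT z|M. indicator (E j) z * (V v z * K (- z + y))) - a j * V (\<pi> (x j) u) y" for j
    proof -
      have "r j y = (LINT z|M. indicator (E j) z * (V v z * K (- z + y)) - indicator (E j) z * V v z * V (\<pi> (x j) u) y)"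
        unfolding r_def by (intro Bochner_Integration.integral_cong) (auto simp: voice_diff voice_orbit algebra_simps)
      also have "\<dots> = (LINT z|M. indicator (E j) z * (V v z * K (- z + y))) - a j * V (\<pi> (x j) u) y"
        unfolding a_def LINT_ind using int_EK int_E by simp
      finally show ?thesis .
    qed
    have "V v y = t y + (\<Sum>j<n. LINT z|M. indicator (E j) z * (V v z * K (- z + y)))"
      using integral_partition[OF voice_reproducing(1)[of v y]]
      by (simp add: voice_reproducing(2) t_def convolution_def mult.assoc)
    moreover have "V (\<Sum>j<n. a j *\<^sub>C \<pi> (x j) u) y = (\<Sum>j<n. a j * V (\<pi> (x j) u) y)"
      by (simp add: voice_def cinner_sum_left cinner_scaleC_left)
    ultimately show ?thesis
      by (simp add: voice_diff r_eq sum_subtractf)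
  qed
  have sum_measure: "(\<Sum>j<n. measure M (E j)) \<le> measure M (A i)"
  proof -
    have "(\<Sum>j<n. measure M (E j)) = measure M (\<Union>j<n. E j)"
      using E(1,2) E_fin
      by (intro measure_finite_Union[symmetric]) (auto simp: disjoint_family_on_def less_top)
    also have "\<dots> \<le> measure M (A i)"
    proof (rule measure_mono_fmeasurable)
      show "(\<Union>j<n. E j) \<subseteq> A i"
        using E(3) by blast
      show "(\<Union>j<n. E j) \<in> sets M"
        using E(2) by blast
      show "A i \<in> fmeasurable M"
        using A(3)[of i] A_sets by (intro fmeasurableI) (auto simp: less_top)
    qed
    finally show ?thesis .
  qed
  have \<epsilon>_sum: "\<epsilon> * (\<Sum>j<n. measure M (E j)) \<le> e"
  proof -
    have "\<epsilon> * (\<Sum>j<n. measure M (E j)) \<le> \<epsilon> * (1 + measure M (A i))"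
      using sum_measure \<epsilon> by (intro mult_left_mono) auto
    also have "\<dots> = e"
    proof -
      have "1 + measure M (A i) \<noteq> 0"
        using measure_nonneg[of M "A i"] by linarith
      then show ?thesis
        by (simp add: \<epsilon>_def)
    qed
    finally show ?thesis .
  qed
  have N_error: "N p (v - (\<Sum>j<n. a j *\<^sub>C \<pi> (x j) u)) \<le> e + norm v * norm u * e" if p: "p \<in> P" for p
  proof -
    have p1: "1 < p"
      using p P by auto
    have t: "t \<in> Lp_fun M p w" "Lp_norm M p w t \<le> e"
    proof -
      let ?q = "2 * p / (p + 1)"
      have "(\<lambda>z. indicator (D n) z * V v z) \<in> Lp_fun M ?q w"
        by (intro Lp_fun_restrict test_spaceD v exponent_gt_1 p1 D_sets)
      note Y = Young_convolution[OF w p1 refl this kernel[OF exponent_gt_1[OF p1]] kernel_symmetric]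
      show "t \<in> Lp_fun M p w"
        unfolding t_def by (rule Y)
      show "Lp_norm M p w t \<le> e"
        using Y(2) n p unfolding t_def negligible_def N_def repr_kernel_def by fastforce
    qed
    have r: "r j \<in> Lp_fun M p w" "Lp_norm M p w (r j) \<le> norm v * norm u * measure M (E j) * \<epsilon>" for j
    proof -
      have close': "N p (\<pi> y u - \<pi> (x j) u) \<le> \<epsilon>" if "y \<in> E j" for y
        using close[OF that p] by simp
      note b = block_error[OF E(2) E_fin p1 less_imp_le[OF \<epsilon>] close' orbit_in_test_space]
      show "r j \<in> Lp_fun M p w"
        unfolding r_def[abs_def] by (rule b)
      show "Lp_norm M p w (r j) \<le> norm v * norm u * measure M (E j) * \<epsilon>"
        unfolding r_def[abs_def] by (rule b)
    qed
    note sum_r = Lp_sum[where N = n and f = r, OF w_measurable p1 r(1)]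
    have "N p (v - (\<Sum>j<n. a j *\<^sub>C \<pi> (x j) u)) = Lp_norm M p w (\<lambda>y. t y + (\<Sum>j<n. r j y))"
      unfolding N_def by (intro arg_cong[where f = "Lp_norm M p w"] ext error)
    also have "\<dots> \<le> Lp_norm M p w t + Lp_norm M p w (\<lambda>y. \<Sum>j<n. r j y)"
      using sum_r by (intro Lp_norm_triangle w_measurable p1 t) auto
    also have "\<dots> \<le> e + (\<Sum>j<n. norm v * norm u * measure M (E j) * \<epsilon>)"
      using t(2) sum_r sum_mono[of "{..<n}", OF r(2)] by (intro add_mono) (auto intro: order.trans)
    also have "(\<Sum>j<n. norm v * norm u * measure M (E j) * \<epsilon>) = norm v * norm u * (\<epsilon> * (\<Sum>j<n. measure M (E j)))"
      by (simp add: sum_distrib_left mult_ac)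
    also have "e + \<dots> \<le> e + norm v * norm u * e"
      using \<epsilon>_sum by (intro add_left_mono mult_left_mono) auto
    finally show ?thesis .
  qed
  have "cmod ((LINT y|M. g y) - (\<Sum>j<n. LINT y:E j|M. g y)) \<le> e"
    using integral_partition[OF g] n unfolding negligible_def LINT_ind by simp
  then show thesis
    using that[of E x \<epsilon> n] E(2) E_fin less_imp_le[OF close] \<epsilon> \<epsilon>_sum N_error unfolding a_def
    by simp
qed


section \<open>Reconstruction of functionals\<close>

lemma cinner_orbit: "cinner (\<pi> x u) v = cnj (V v x)"
  by (simp add: voice_def cinner_commute[of v])

text \<open>Both sides are compared with their values for the approximating sum: on the left through the
  boundedness of \<open>T\<close>, on the right because \<open>T(\<pi>(x)u)\<close> is nearly constant on each set of the partition.
  Allowing an almost everywhere equal \<open>f\<close> makes the formula apply to a representative of the class of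
  the extended voice transform.\<close>

lemma functional_reconstruction:
  assumes T: "T \<in> antidual_test_space M \<pi> u w" and v: "v \<in> S"
    and f: "AE x in M. f x = T (\<pi> x u)"
    and g: "integrable M (\<lambda>x. f x * cinner (\<pi> x u) v)"
  shows "T v = (LINT x|M. f x * cinner (\<pi> x u) v)"
proof -
  let ?g = "\<lambda>x. f x * cinner (\<pi> x u) v"
  define C where "C = norm v * norm u"
  have C: "0 \<le> C" "\<And>x. cmod (V v x) \<le> C"
    by (auto simp: C_def voice_bound)
  obtain P c where P: "finite P" "P \<subseteq> {1<..}" "0 \<le> c"
    and T_le: "\<And>v. v \<in> S \<Longrightarrow> cmod (T v) \<le> c * (\<Sum>p\<in>P. N p v)"
    using antidual_bounded[OF T] by blast
  define d where "d = c * real (card P)"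
  have d: "0 \<le> d"
    using P by (simp add: d_def)
  have T_bound: "cmod (T v') \<le> d * s" if "v' \<in> S" "\<And>p. p \<in> P \<Longrightarrow> N p v' \<le> s" for v' s
  proof -
    have "cmod (T v') \<le> c * (\<Sum>p\<in>P. N p v')"
      using T_le that by blast
    also have "\<dots> \<le> c * (real (card P) * s)"
      using P that by (intro mult_left_mono sum_bounded_above) auto
    finally show ?thesis
      by (simp add: d_def mult.assoc)
  qed
  have bound: "cmod (T v - (LINT x|M. ?g x)) \<le> (d * (1 + C) + 1 + C * d) * e" if e: "0 < e" for e
  proof -
    obtain n and E :: "nat \<Rightarrow> 'g set" and x :: "nat \<Rightarrow> 'g" and \<epsilon> where
      E: "\<forall>j. E j \<in> sets M \<and> emeasure M (E j) < \<infinity>"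
      and close: "\<forall>j. \<forall>y\<in>E j. \<forall>p\<in>P. N p (\<pi> y u - \<pi> (x j) u) \<le> \<epsilon>"
      and \<epsilon>: "0 \<le> \<epsilon>" "\<epsilon> * (\<Sum>j<n. measure M (E j)) \<le> e"
      and approx: "\<forall>p\<in>P. N p (v - (\<Sum>j<n. (LINT y:E j|M. V v y) *\<^sub>C \<pi> (x j) u)) \<le> e + norm v * norm u * e"
      and rest: "cmod ((LINT y|M. ?g y) - (\<Sum>j<n. LINT y:E j|M. ?g y)) \<le> e"
      by (rule approximation[OF v P(1,2) g e]) (erule (5) that)
    define a where "a j = (LINT y:E j|M. V v y)" for j
    define v' where "v' = (\<Sum>j<n. a j *\<^sub>C \<pi> (x j) u)"
    have v': "v' \<in> S"
      unfolding v'_def by (intro test_space_sum test_space_scale orbit_in_test_space)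
    have "cmod (T (v - v')) \<le> d * (e + C * e)"
      using approx by (intro T_bound test_space_diff v v') (simp add: v'_def a_def C_def)
    then have err1: "cmod (T v - T v') \<le> d * (1 + C) * e"
      by (simp add: antidual_diff[OF T v v'] algebra_simps)
    have T_v': "T v' = (\<Sum>j<n. cnj (a j) * T (\<pi> (x j) u))"
      unfolding v'_def
      by (subst antidual_sum[OF T]) (auto simp: antidual_scale[OF T] test_space_scale orbit_in_test_space)
    have block: "cmod (cnj (a j) * T (\<pi> (x j) u) - (LINT y:E j|M. ?g y)) \<le> C * d * (\<epsilon> * measure M (E j))" for j
    proof -
      have Ej [measurable]: "E j \<in> sets M" "emeasure M (E j) < \<infinity>"
        using E by auto
      have ind: "integrable M (\<lambda>y. indicator (E j) y * s)" for s :: real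
        using Ej by (intro integrable_mult_left integrable_real_indicator)
      have int_V: "integrable M (\<lambda>y. indicator (E j) y *\<^sub>R V v y)"
        by (rule Bochner_Integration.integrable_bound[OF ind[of C]])
           (use C in \<open>auto simp: indicator_def\<close>)
      then have int_cV: "integrable M (\<lambda>y. indicator (E j) y *\<^sub>R cinner (\<pi> y u) v)"
        using integrable_cnj[of M "\<lambda>y. indicator (E j) y *\<^sub>R V v y"] by (simp add: cinner_orbit)
      have int_g: "integrable M (\<lambda>y. indicator (E j) y *\<^sub>R ?g y)"
        by (rule integrable_mult_indicator[OF Ej(1) g])
      have cnj_a: "cnj (a j) = (LINT y|M. indicator (E j) y *\<^sub>R cinner (\<pi> y u) v)"
        using Bochner_Integration.integral_cnj[of M "\<lambda>y. indicator (E j) y *\<^sub>R V v y"]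
        by (simp add: a_def set_lebesgue_integral_def cinner_orbit)
      have "cnj (a j) * T (\<pi> (x j) u) - (LINT y:E j|M. ?g y)
          = (LINT y|M. (indicator (E j) y *\<^sub>R cinner (\<pi> y u) v) * T (\<pi> (x j) u) - indicator (E j) y *\<^sub>R ?g y)"
        unfolding set_lebesgue_integral_def cnj_a
        by (subst Bochner_Integration.integral_diff[OF integrable_mult_left[OF int_cV] int_g])
           (simp del: mult_scaleR_left)
      also have "cmod \<dots> \<le> (LINT y|M. indicator (E j) y * (C * (d * \<epsilon>)))"
      proof (rule order.trans[OF integral_norm_bound integral_mono_AE[OF _ ind]])
        show "AE y in M. cmod ((indicator (E j) y *\<^sub>R cinner (\<pi> y u) v) * T (\<pi> (x j) u) - indicator (E j) y *\<^sub>R ?g y)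
            \<le> indicator (E j) y * (C * (d * \<epsilon>))"
          using f
        proof eventually_elim
          case (elim y)
          have "cmod (cinner (\<pi> y u) v * T (\<pi> (x j) u) - ?g y) \<le> C * (d * \<epsilon>)" if "y \<in> E j"
          proof -
            have "cinner (\<pi> y u) v * T (\<pi> (x j) u) - ?g y = - (cnj (V v y) * T (\<pi> y u - \<pi> (x j) u))"
              unfolding antidual_diff[OF T orbit_in_test_space orbit_in_test_space] elim cinner_orbit
              by (simp add: algebra_simps)
            then have "cmod (cinner (\<pi> y u) v * T (\<pi> (x j) u) - ?g y) = cmod (V v y) * cmod (T (\<pi> y u - \<pi> (x j) u))"
              by (simp only: norm_minus_cancel norm_mult complex_mod_cnj)
            also have "\<dots> \<le> C * (d * \<epsilon>)"
              using C close that
              by (intro mult_mono T_bound test_space_diff orbit_in_test_space) auto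
            finally show ?thesis .
          qed
          then show ?case
            by (auto simp: indicator_def)
        qed
      qed (intro integrable_norm Bochner_Integration.integrable_diff integrable_mult_left int_cV int_g)
      also have "\<dots> = C * d * (\<epsilon> * measure M (E j))"
        by simp
      finally show ?thesis .
    qed
    have "cmod (T v' - (\<Sum>j<n. LINT y:E j|M. ?g y)) \<le> (\<Sum>j<n. C * d * (\<epsilon> * measure M (E j)))"
      unfolding T_v' sum_subtractf[symmetric] by (intro order.trans[OF norm_sum] sum_mono block)
    also have "\<dots> = C * d * (\<epsilon> * (\<Sum>j<n. measure M (E j)))"
      by (simp add: sum_distrib_left)
    also have "\<dots> \<le> C * d * e"
      using C d \<epsilon> by (intro mult_left_mono) auto
    finally have err2: "cmod (T v' - (\<Sum>j<n. LINT y:E j|M. ?g y)) \<le> C * d * e" .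
    have "cmod (T v - (LINT x|M. ?g x)) \<le> cmod (T v - T v') + cmod (T v' - (\<Sum>j<n. LINT y:E j|M. ?g y))
        + cmod ((LINT x|M. ?g x) - (\<Sum>j<n. LINT y:E j|M. ?g y))"
      using norm_triangle_ineq4[of "T v - (\<Sum>j<n. LINT y:E j|M. ?g y)" "(LINT x|M. ?g x) - (\<Sum>j<n. LINT y:E j|M. ?g y)"]
        norm_triangle_ineq[of "T v - T v'" "T v' - (\<Sum>j<n. LINT y:E j|M. ?g y)"]
      by simp
    also have "\<dots> \<le> d * (1 + C) * e + C * d * e + e"
      by (intro add_mono err1 err2 rest)
    also have "\<dots> = (d * (1 + C) + 1 + C * d) * e"
      by (simp add: algebra_simps)
    finally show ?thesis .
  qed
  have "cmod (T v - (LINT x|M. ?g x)) \<le> e" if e: "0 < e" for e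
  proof -
    define k where "k = d * (1 + C) + 1 + C * d"
    have k: "0 < k"
      unfolding k_def using C d by (intro add_pos_nonneg add_nonneg_pos mult_nonneg_nonneg) auto
    then show ?thesis
      using bound[of "e / k"] e by (simp add: k_def[symmetric])
  qed
  then have "cmod (T v - (LINT x|M. ?g x)) \<le> 0"
    by (rule dense_ge)
  then show ?thesis
    by simp
qed

section \<open>The pairing of \<open>L\<^sub>2\<close> with the test space\<close>

lemma m_measurable [measurable]: "m \<in> borel_measurable M"
proof -
  have "continuous_on UNIV m"
    using m by (simp add: moderate_weight_def)
  then show ?thesis
    unfolding measurable_cong_sets[OF sets_M refl] by (rule borel_measurable_continuous_onI)
qed

lemma m_pos: "0 < m x"
  using m by (simp add: moderate_weight_def)

lemma m_ge_inverse_w: "1 \<le> (1 / m 0) * \<bar>m x\<bar> * \<bar>w x\<bar>"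
proof -
  have "m (x + - x) \<le> m x * w (- x)"
    using m unfolding moderate_weight_def by blast
  also have "w (- x) = w x"
    using w by (simp add: control_weight_def)
  finally show ?thesis
    using m_pos[of 0] m_pos[of x] w_pos[of x] by (simp add: field_simps)
qed

text \<open>The integral that defines the Fourier transform \<open>\<pi>(f)u\<close>, estimated so as to show its continuity
  in \<open>v\<close>; with \<open>v = \<pi>(y)u\<close> it is the convolution \<open>f * K\<close> at \<open>y\<close>.\<close>

lemma pairing:
  assumes f: "f \<in> Lp_fun M 2 m" and v: "v \<in> S"
  shows "integrable M (\<lambda>x. f x * cinner (\<pi> x u) v)"
    and "cmod (LINT x|M. f x * cinner (\<pi> x u) v) \<le> (1 / m 0) * Lp_norm M 2 m f * N 2 v"
proof -
  have eq: "cmod (of_real (w x) * cinner (\<pi> x u) v) = cmod (of_real (w x) * V v x)" for x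
    by (simp add: norm_mult cinner_orbit)
  have "(\<lambda>x. cinner (\<pi> x u) v) \<in> Lp_fun M 2 w" "Lp_norm M 2 w (\<lambda>x. cinner (\<pi> x u) v) = N 2 v"
    using test_spaceD[OF v, of 2] cnj_voice_measurable[of v]
    unfolding N_def Lp_fun_def Lp_norm_def mem_Collect_eq eq
    by (simp_all add: cinner_orbit)
  then show "integrable M (\<lambda>x. f x * cinner (\<pi> x u) v)"
    and "cmod (LINT x|M. f x * cinner (\<pi> x u) v) \<le> (1 / m 0) * Lp_norm M 2 m f * N 2 v"
    using Lp_duality[OF m_measurable w_measurable f _ m_ge_inverse_w, of "\<lambda>x. cinner (\<pi> x u) v"] by auto
qed

lemma convolution_kernel: "convolution M f K y = (LINT x|M. f x * cinner (\<pi> x u) (\<pi> y u))"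
  by (simp add: convolution_def kernel_quotient)

lemma convolution_cong_AE:
  assumes [measurable]: "f \<in> borel_measurable M" "g \<in> borel_measurable M" and "AE x in M. f x = g x"
  shows "convolution M f K = convolution M g K"
proof
  fix y
  have [measurable]: "(\<lambda>x. K (- x + y)) \<in> borel_measurable M"
    using cnj_voice_measurable[of "\<pi> y u"] by (simp add: kernel_quotient cinner_orbit)
  show "convolution M f K y = convolution M g K y"
    unfolding convolution_def using assms(3) by (intro integral_cong_AE) auto
qed

section \<open>The reproducing kernel subspace\<close>

abbreviation "R \<equiv> reproducing_kernel_subspace M \<pi> u m"

lemma Y_space_rep:
  assumes "F \<in> Y_space M m"
  shows "1 < p \<Longrightarrow> rep F \<in> Lp_fun M p m" "ae_class M (rep F) = F"
proof -
  have F: "F \<in> Lp_space M p m" if "1 < p" for p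
    using assms that by (simp add: Y_space_def)
  show "1 < p \<Longrightarrow> rep F \<in> Lp_fun M p m"
    using Lp_space_rep(1)[OF m_measurable F] .
  show "ae_class M (rep F) = F"
    using Lp_space_rep(2)[OF m_measurable F[of 2]] by simp
qed

lemma convolution_fixed_iff:
  assumes "rep F \<in> borel_measurable M" "ae_class M (rep F) = F"
  shows "ae_class M (convolution M (rep F) K) = F \<longleftrightarrow> (AE x in M. convolution M (rep F) K x = rep F x)"
proof
  assume "ae_class M (convolution M (rep F) K) = F"
  moreover have "rep F \<in> F"
    using assms by (metis (mono_tags, lifting) ae_class_def AE_I2 mem_Collect_eq)
  ultimately have "rep F \<in> ae_class M (convolution M (rep F) K)"
    by simp
  then show "AE x in M. convolution M (rep F) K x = rep F x"
    by (auto simp: ae_class_def elim: eventually_mono)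
next
  assume "AE x in M. convolution M (rep F) K x = rep F x"
  then show "ae_class M (convolution M (rep F) K) = F"
    using ae_class_cong assms(2) by metis
qed

lemma R_rep:
  assumes "F \<in> R"
  shows "F \<in> Y_space M m" "AE x in M. convolution M (rep F) K x = rep F x"
proof -
  show F: "F \<in> Y_space M m"
    using assms by (simp add: reproducing_kernel_subspace_def)
  show "AE x in M. convolution M (rep F) K x = rep F x"
    using assms convolution_fixed_iff[OF Lp_fun_measurable[OF Y_space_rep(1)[OF F]] Y_space_rep(2)[OF F], of 2]
    by (simp add: reproducing_kernel_subspace_def)
qed

lemma ae_class_in_R:
  assumes f: "\<And>p. 1 < p \<Longrightarrow> f \<in> Lp_fun M p m" and fixed: "AE x in M. convolution M f K x = f x"
  shows "ae_class M f \<in> R"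
proof -
  have meas: "f \<in> borel_measurable M"
    using f[of 2] by (simp add: Lp_fun_def)
  note r = rep_ae_class[OF meas]
  have "convolution M (rep (ae_class M f)) K = convolution M f K"
    by (rule convolution_cong_AE[OF r(1) meas r(2)])
  then show ?thesis
    using f ae_class_cong[OF fixed] by (auto simp: reproducing_kernel_subspace_def Y_space_def Lp_space_def)
qed

lemma convolution_linear:
  assumes "f \<in> Lp_fun M 2 m" "g \<in> Lp_fun M 2 m"
  shows "convolution M (\<lambda>x. f x + g x) K y = convolution M f K y + convolution M g K y"
    and "convolution M (\<lambda>x. f x - g x) K y = convolution M f K y - convolution M g K y"
    and "convolution M (\<lambda>x. c * f x) K y = c * convolution M f K y"
  unfolding convolution_kernel
  using pairing(1)[OF assms(1) orbit_in_test_space] pairing(1)[OF assms(2) orbit_in_test_space]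
  by (simp_all add: distrib_right left_diff_distrib mult.assoc)

text \<open>Convolution with \<open>K\<close> is continuous from \<open>L\<^sub>2\<close> with weight \<open>m\<close> to pointwise convergence, whereas the
  functions themselves converge almost everywhere only along a subsequence; both limits agree almost
  everywhere.\<close>

lemma convolution_fixed_limit:
  assumes F: "F \<in> Lp_space M 2 m" and H: "\<And>n. H n \<in> Lp_space M 2 m"
    and fixed: "\<And>n. ae_class M (convolution M (rep (H n)) K) = H n"
    and lim: "(\<lambda>n. Lp_norm M 2 m (\<lambda>x. rep F x - rep (H n) x)) \<longlonglongrightarrow> 0"
  shows "ae_class M (convolution M (rep F) K) = F"
proof -
  note rF = Lp_space_rep[OF m_measurable F] and rH = Lp_space_rep[OF m_measurable H]
  have two: "(1::real) < 2"
    by simp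
  note diff = Lp_fun_diff[OF m_measurable two rF(1) rH(1)]
  define D where "D n x = cmod (of_real (m x) * (rep F x - rep (H n) x)) powr 2" for n x
  have int_D: "integrable M (D n)" for n
    using Lp_fun_integrable[OF diff] by (simp add: D_def[abs_def])
  have D_nonneg: "0 \<le> D n x" for n x
    by (simp add: D_def)
  have "(\<lambda>n. (Lp_norm M 2 m (\<lambda>x. rep F x - rep (H n) x))\<^sup>2) \<longlonglongrightarrow> 0"
    using tendsto_power[OF lim, of 2] by simp
  moreover have "(Lp_norm M 2 m (\<lambda>x. rep F x - rep (H n) x))\<^sup>2 = (LINT x|M. norm (D n x))" for n
    using Lp_norm_powr[of 2 M m "\<lambda>x. rep F x - rep (H n) x"] by (simp add: D_def)
  ultimately have "(\<lambda>n. LINT x|M. norm (D n x)) \<longlonglongrightarrow> 0"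
    by simp
  then obtain r :: "nat \<Rightarrow> nat" where r: "strict_mono r" "AE x in M. (\<lambda>n. D (r n) x) \<longlonglongrightarrow> 0"
    using tendsto_L1_AE_subseq[of M D] int_D by auto
  have "AE x in M. \<forall>n. convolution M (rep (H n)) K x = rep (H n) x"
    unfolding AE_all_countable
    using fixed convolution_fixed_iff[OF Lp_fun_measurable[OF rH(1)] rH(2)] by blast
  with r(2) have "AE x in M. convolution M (rep F) K x = rep F x"
  proof eventually_elim
    case (elim x)
    have "(\<lambda>n. convolution M (rep F) K x - convolution M (rep (H (r n))) K x) \<longlonglongrightarrow> 0"
    proof (rule Lim_null_comparison)
      show "\<forall>\<^sub>F n in sequentially. norm (convolution M (rep F) K x - convolution M (rep (H (r n))) K x)
          \<le> (1 / m 0) * Lp_norm M 2 m (\<lambda>x. rep F x - rep (H (r n)) x) * N 2 (\<pi> x u)"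
        unfolding convolution_linear(2)[OF rF(1) rH(1), symmetric]
        unfolding convolution_kernel
        by (intro always_eventually allI pairing(2) diff orbit_in_test_space)
      show "(\<lambda>n. (1 / m 0) * Lp_norm M 2 m (\<lambda>x. rep F x - rep (H (r n)) x) * N 2 (\<pi> x u)) \<longlonglongrightarrow> 0"
        using LIMSEQ_subseq_LIMSEQ[OF lim r(1)]
        by (intro tendsto_mult_left_zero tendsto_mult_right_zero) (simp add: comp_def)
    qed
    then have "(\<lambda>n. convolution M (rep F) K x - rep (H (r n)) x) \<longlonglongrightarrow> 0"
      using elim by simp
    moreover have "(\<lambda>n. rep F x - rep (H (r n)) x) \<longlonglongrightarrow> 0"
    proof -
      have "(\<lambda>n. sqrt (D (r n) x)) \<longlonglongrightarrow> 0"
        using tendsto_real_sqrt[OF elim(1)] by simp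
      then have "(\<lambda>n. m x * cmod (rep F x - rep (H (r n)) x)) \<longlonglongrightarrow> 0"
        using m_pos[of x] by (simp add: D_def norm_mult)
      then have "(\<lambda>n. (1 / m x) * (m x * cmod (rep F x - rep (H (r n)) x))) \<longlonglongrightarrow> 0"
        by (rule tendsto_mult_right_zero)
      then show ?thesis
        using m_pos[of x] by (simp add: tendsto_norm_zero_iff)
    qed
    ultimately have "(\<lambda>n. (convolution M (rep F) K x - rep (H (r n)) x) - (rep F x - rep (H (r n)) x)) \<longlonglongrightarrow> 0 - 0"
      by (rule tendsto_diff)
    then show ?case
      by (simp add: LIMSEQ_const_iff)
  qed
  then show ?thesis
    using convolution_fixed_iff[OF Lp_fun_measurable[OF rF(1)] rF(2)] by simp
qed

lemma topspace_Y_topology: "topspace (Y_topology M m) = Y_space M m"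
proof -
  have "openin (Lp_topology M 2 m) (Lp_space M 2 m)"
    unfolding Lp_topology_def
    by (intro Metric_space.open_in_mspace Metric_space_Lp m_measurable less_imp_neq[THEN not_sym] m_pos) simp
  moreover have "Y_space M m \<inter> Lp_space M 2 m = Y_space M m"
    by (auto simp: Y_space_def)
  ultimately have "Y_space M m \<in> {Y_space M m \<inter> U | U p. 1 < p \<and> openin (Lp_topology M p m) U}"
    unfolding mem_Collect_eq by (intro exI[of _ "Lp_space M 2 m"] exI[of _ 2]) simp
  then show ?thesis
    unfolding Y_topology_def topology_generated_by_topspace by blast
qed

text \<open>The complement of \<open>R\<close> in \<open>Y\<close> is the trace of an open set of the single space \<open>L\<^sub>2\<close>, hence one of
  the generating open sets of the initial topology.\<close>

lemma closedin_R: "closedin (Y_topology M m) R"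
proof -
  interpret L2: Metric_space "Lp_space M 2 m" "\<lambda>F G. Lp_norm M 2 m (rep (diff_class M F G))"
    by (intro Metric_space_Lp m_measurable less_imp_neq[THEN not_sym] m_pos) simp
  define U where "U = {F \<in> Lp_space M 2 m. ae_class M (convolution M (rep F) K) \<noteq> F}"
  have "openin (Lp_topology M 2 m) U"
    unfolding Lp_topology_def L2.openin_mtopology
  proof (intro conjI allI impI)
    show "U \<subseteq> Lp_space M 2 m"
      by (auto simp: U_def)
    fix F assume F: "F \<in> U"
    show "\<exists>r>0. L2.mball F r \<subseteq> U"
    proof (rule ccontr)
      assume "\<not> (\<exists>r>0. L2.mball F r \<subseteq> U)"
      then have "\<forall>n. \<exists>H. H \<in> L2.mball F (inverse (real (Suc n))) \<and> H \<notin> U"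
        by (metis inverse_positive_iff_positive of_nat_0_less_iff subsetI zero_less_Suc)
      then obtain H where H: "\<And>n. H n \<in> L2.mball F (inverse (real (Suc n)))" "\<And>n. H n \<notin> U"
        by metis
      have H2: "H n \<in> Lp_space M 2 m" and F2: "F \<in> Lp_space M 2 m" for n
        using H(1)[of n] by simp_all
      have "(\<lambda>n. Lp_norm M 2 m (\<lambda>x. rep F x - rep (H n) x)) \<longlonglongrightarrow> 0"
      proof (rule Lim_null_comparison[OF _ LIMSEQ_inverse_real_of_nat])
        show "\<forall>\<^sub>F n in sequentially. norm (Lp_norm M 2 m (\<lambda>x. rep F x - rep (H n) x)) \<le> inverse (real (Suc n))"
          using H(1) by (intro always_eventually allI)
            (simp add: Lp_dist_eq[OF m_measurable F2 H2, symmetric] less_imp_le)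
      qed
      then have "ae_class M (convolution M (rep F) K) = F"
        using H(2) by (intro convolution_fixed_limit[OF F2 H2]) (auto simp: U_def H2)
      then show False
        using F by (simp add: U_def)
    qed
  qed
  then have "openin (Y_topology M m) (Y_space M m \<inter> U)"
    unfolding Y_topology_def
    by (intro topology_generated_by_Basis) (use one_less_numeral_iff in force)
  moreover have "Y_space M m - R = Y_space M m \<inter> U"
    by (auto simp: U_def reproducing_kernel_subspace_def Y_space_def)
  ultimately show ?thesis
    by (auto simp: closedin_def topspace_Y_topology reproducing_kernel_subspace_def)
qed

lemma closed_linear_subspace_R: "closed_linear_subspace_of_Y M m R"
  unfolding closed_linear_subspace_of_Y_def
proof (intro conjI ballI allI)
  show "R \<subseteq> Y_space M m"
    by (auto simp: reproducing_kernel_subspace_def)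
  show "ae_class M (\<lambda>x. 0) \<in> R"
    by (rule ae_class_in_R) (auto simp: convolution_def)
  show "closedin (Y_topology M m) R"
    by (rule closedin_R)
  fix F assume F: "F \<in> R"
  note F' = Y_space_rep(1)[OF R_rep(1)[OF F]] R_rep(2)[OF F]
  show "scale_class M c F \<in> R" for c
    unfolding scale_class_def
  proof (rule ae_class_in_R)
    show "AE x in M. convolution M (\<lambda>x. c * rep F x) K x = c * rep F x"
      using F'(2) by eventually_elim (simp add: convolution_linear(3)[OF F'(1) F'(1)])
  qed (intro Lp_fun_scale F'(1))
  fix G assume G: "G \<in> R"
  note G' = Y_space_rep(1)[OF R_rep(1)[OF G]] R_rep(2)[OF G]
  show "add_class M F G \<in> R"
    unfolding add_class_def
  proof (rule ae_class_in_R)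
    show "AE x in M. convolution M (\<lambda>x. rep F x + rep G x) K x = rep F x + rep G x"
      using F'(2) G'(2) by eventually_elim (simp add: convolution_linear(1)[OF F'(1) G'(1)])
  qed (intro Lp_fun_add m_measurable F'(1) G'(1))
qed

section \<open>Coorbits and the reproducing kernel subspace\<close>

lemma fourier_at_apply: "v \<in> S \<Longrightarrow> fourier_at M \<pi> u w F v = (LINT x|M. rep F x * cinner (\<pi> x u) v)"
  by (simp add: fourier_at_def)

lemma fourier_at_antidual:
  assumes F: "F \<in> Y_space M m"
  shows "fourier_at M \<pi> u w F \<in> antidual_test_space M \<pi> u w"
proof -
  let ?T = "fourier_at M \<pi> u w F"
  have f: "rep F \<in> Lp_fun M 2 m"
    by (intro Y_space_rep F) simp
  have add: "?T (v + v') = ?T v + ?T v'" if "v \<in> S" "v' \<in> S" for v v'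
    using that pairing(1)[OF f]
    by (simp add: fourier_at_apply test_space_add cinner_add_right distrib_left)
  have scale: "?T (c *\<^sub>C v) = cnj c * ?T v" if "v \<in> S" for c v
    using that by (simp add: fourier_at_apply test_space_scale cinner_scaleC_right mult.left_commute)
  have "continuous_map (test_topology M \<pi> u w) euclidean ?T"
    unfolding continuous_map_def
  proof (intro conjI allI impI)
    fix U :: "complex set" assume "openin euclidean U"
    then have U: "open U"
      by simp
    show "openin (test_topology M \<pi> u w) {v \<in> topspace (test_topology M \<pi> u w). ?T v \<in> U}"
    proof (subst openin_subopen, intro ballI)
      fix v\<^sub>0 assume "v\<^sub>0 \<in> {v \<in> topspace (test_topology M \<pi> u w). ?T v \<in> U}"
      then have v\<^sub>0: "v\<^sub>0 \<in> S" "?T v\<^sub>0 \<in> U"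
        by (auto simp: topspace_test_topology)
      obtain e where e: "0 < e" "ball (?T v\<^sub>0) e \<subseteq> U"
        using U v\<^sub>0(2) open_contains_ball by blast
      define c where "c = (1 / m 0) * Lp_norm M 2 m (rep F) + 1"
      have c: "0 < c"
        unfolding c_def using m_pos[of 0] by (intro add_nonneg_pos mult_nonneg_nonneg) auto
      define B where "B = {v \<in> S. Lp_norm M 2 w (V (v - v\<^sub>0)) < e / c}"
      have "B \<in> {{v \<in> S. Lp_norm M p w (V (v - v\<^sub>0)) < \<epsilon>} | v\<^sub>0 p \<epsilon>. v\<^sub>0 \<in> S \<and> 1 < p \<and> 0 < \<epsilon>}"
        unfolding B_def mem_Collect_eq using v\<^sub>0 e c
        by (intro exI[of _ v\<^sub>0] exI[of _ 2] exI[of _ "e / c"]) simp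
      then have "openin (test_topology M \<pi> u w) B"
        unfolding test_topology_def by (rule topology_generated_by_Basis)
      moreover have "v\<^sub>0 \<in> B"
        using v\<^sub>0 e c by (simp add: B_def voice_zero)
      moreover have "?T v \<in> U" if v: "v \<in> B" for v
      proof -
        have vS: "v \<in> S" and N_lt: "N 2 (v - v\<^sub>0) < e / c"
          using v by (auto simp: B_def N_def)
        have "?T v = ?T (v - v\<^sub>0) + ?T v\<^sub>0"
          using add[OF test_space_diff[OF vS v\<^sub>0(1)] v\<^sub>0(1)] by simp
        then have "dist (?T v\<^sub>0) (?T v) = cmod (?T (v - v\<^sub>0))"
          by (simp add: dist_norm)
        also have "\<dots> \<le> (1 / m 0) * Lp_norm M 2 m (rep F) * N 2 (v - v\<^sub>0)"
          using pairing(2)[OF f test_space_diff[OF vS v\<^sub>0(1)]]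
          by (simp add: fourier_at_apply test_space_diff[OF vS v\<^sub>0(1)])
        also have "\<dots> \<le> c * N 2 (v - v\<^sub>0)"
          by (intro mult_right_mono N_nonneg) (simp add: c_def)
        also have "\<dots> < e"
          using N_lt c by (simp add: field_simps)
        finally show ?thesis
          using e(2) by auto
      qed
      ultimately show "\<exists>B. openin (test_topology M \<pi> u w) B \<and> v\<^sub>0 \<in> B \<and>
          B \<subseteq> {v \<in> topspace (test_topology M \<pi> u w). ?T v \<in> U}"
        by (intro exI[of _ B]) (auto simp: topspace_test_topology B_def)
    qed
  qed auto
  moreover have "?T \<in> extensional S"
    by (simp add: fourier_at_def)
  ultimately show ?thesis
    using add scale by (simp add: antidual_test_space_def)
qed

lemma ext_voice_fourier_at: "ext_voice \<pi> u (fourier_at M \<pi> u w F) = convolution M (rep F) K"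
  by (simp add: fun_eq_iff ext_voice_def fourier_at_apply orbit_in_test_space convolution_kernel)

lemma ext_voice_class_fourier_at:
  assumes "F \<in> R"
  shows "ext_voice_class M \<pi> u (fourier_at M \<pi> u w F) = F"
  using assms by (simp add: ext_voice_class_def ext_voice_fourier_at reproducing_kernel_subspace_def)

lemma fourier_at_coorbit:
  assumes "F \<in> R"
  shows "fourier_at M \<pi> u w F \<in> coorbit_space M \<pi> u w m"
  using fourier_at_antidual[OF R_rep(1)[OF assms]] ext_voice_class_fourier_at[OF assms] R_rep(1)[OF assms]
  by (simp add: coorbit_space_def)

lemma fourier_at_ext_voice_class:
  assumes T: "T \<in> coorbit_space M \<pi> u w m"
  shows "fourier_at M \<pi> u w (ext_voice_class M \<pi> u T) = T"
proof (rule extensionalityI)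
  let ?F = "ext_voice_class M \<pi> u T"
  have F: "?F \<in> Y_space M m" and T': "T \<in> antidual_test_space M \<pi> u w"
    using T by (auto simp: coorbit_space_def)
  show "fourier_at M \<pi> u w ?F \<in> extensional S"
    by (simp add: fourier_at_def)
  show "T \<in> extensional S"
    using T' by (simp add: antidual_test_space_def)
  fix v assume v: "v \<in> S"
  have f: "rep ?F \<in> Lp_fun M 2 m"
    by (intro Y_space_rep F) simp
  have "rep ?F \<in> ?F"
    using Y_space_rep(2)[OF F] Lp_fun_measurable[OF f]
    by (metis (mono_tags, lifting) ae_class_def AE_I2 mem_Collect_eq)
  then have "AE x in M. rep ?F x = T (\<pi> x u)"
    by (simp add: ext_voice_class_def ae_class_def ext_voice_def)
  then show "fourier_at M \<pi> u w ?F v = T v"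
    using functional_reconstruction[OF T' v _ pairing(1)[OF f v]] by (simp add: fourier_at_apply v)
qed

lemma ext_voice_class_in_R:
  assumes T: "T \<in> coorbit_space M \<pi> u w m"
  shows "ext_voice_class M \<pi> u T \<in> R"
proof -
  let ?F = "ext_voice_class M \<pi> u T"
  have "convolution M (rep ?F) K = ext_voice \<pi> u T"
    using ext_voice_fourier_at[of ?F] fourier_at_ext_voice_class[OF T] by simp
  then have "ae_class M (convolution M (rep ?F) K) = ?F"
    by (simp add: ext_voice_class_def)
  then show ?thesis
    using T by (simp add: reproducing_kernel_subspace_def coorbit_space_def)
qed

lemma bij_betw_ext_voice_class:
  "bij_betw (ext_voice_class M \<pi> u) (coorbit_space M \<pi> u w m) R"
  by (rule bij_betwI[where g = "fourier_at M \<pi> u w"])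
     (auto intro: ext_voice_class_in_R fourier_at_coorbit simp: fourier_at_ext_voice_class ext_voice_class_fourier_at)

end

theorem theorem4:
  fixes M :: "'g::{topological_group_add, second_countable_topology, t2_space} measure"
    and \<pi> :: "'g \<Rightarrow> 'h::complex_hilbert_space \<Rightarrow> 'h"
    and u :: 'h
    and w m :: "'g \<Rightarrow> real"
  assumes "locally_compact_space (euclidean :: 'g topology)"
    and "left_haar_measure M"
    and "separable_space (euclidean :: 'h topology)"
    and "reproducing_representation M \<pi> u"
    and "control_weight w"
    and "\<And>p. 1 < p \<Longrightarrow> repr_kernel \<pi> u \<in> Lp_fun M p w"
    and "moderate_weight w m"
  shows "(ext_voice_class M \<pi> u ` coorbit_space M \<pi> u w m = reproducing_kernel_subspace M \<pi> u m
          \<and> closed_linear_subspace_of_Y M m (reproducing_kernel_subspace M \<pi> u m))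
       \<and> (\<forall>f\<in>reproducing_kernel_subspace M \<pi> u m.
            (\<forall>v\<in>test_space M \<pi> u w. integrable M (\<lambda>x. rep f x * cinner (\<pi> x u) v))
          \<and> fourier_at M \<pi> u w f \<in> coorbit_space M \<pi> u w m)
       \<and> ((\<forall>f\<in>reproducing_kernel_subspace M \<pi> u m.
             ext_voice_class M \<pi> u (fourier_at M \<pi> u w f) = f)
          \<and> (\<forall>T\<in>coorbit_space M \<pi> u w m.
             fourier_at M \<pi> u w (ext_voice_class M \<pi> u T) = T))
       \<and> (bij_betw (ext_voice_class M \<pi> u) (coorbit_space M \<pi> u w m)
            (reproducing_kernel_subspace M \<pi> u m)
          \<and> (\<forall>f\<in>reproducing_kernel_subspace M \<pi> u m.
             the_inv_into (coorbit_space M \<pi> u w m) (ext_voice_class M \<pi> u) f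
               = fourier_at M \<pi> u w f))"
proof -
  interpret coorbit_setting M \<pi> u w m
    by unfold_locales (fact assms(1,2,4,5,6,7))+
  have inverse: "the_inv_into (coorbit_space M \<pi> u w m) (ext_voice_class M \<pi> u) f = fourier_at M \<pi> u w f"
    if "f \<in> R" for f
    using that bij_betw_imp_inj_on[OF bij_betw_ext_voice_class]
    by (intro the_inv_into_f_eq ext_voice_class_fourier_at fourier_at_coorbit)
  have integrable: "integrable M (\<lambda>x. rep f x * cinner (\<pi> x u) v)" if "f \<in> R" "v \<in> S" for f v
    by (intro pairing(1) Y_space_rep(1)[OF R_rep(1)] that) simp
  show ?thesis
    by (intro conjI ballI bij_betw_imp_surj_on[OF bij_betw_ext_voice_class] closed_linear_subspace_R
        bij_betw_ext_voice_class integrable inverse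
        fourier_at_coorbit ext_voice_class_fourier_at fourier_at_ext_voice_class)
qed

end
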